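(* Let $F\subset\mathbb{T}$ be a finite subset, and let $L_F$ be the restriction of $H=z\frac{d}{dz}$ to $\{f\in\mathscr{H}_2 : z\frac{d}{dz}f\in\mathscr{H}_2,\ \tilde f=0\text{ on }F\}$. Then the partial isometries $U_F$ between the two deficiency spaces $\mathscr{D}_\pm(L_F)$, i.e. the elements of $$\mathscr{C}(L_F)=\{U:\mathscr{D}_+(L_F)\to\mathscr{D}_-(L_F) : U^*U=P_{\mathscr{D}_+(L_F)},\ UU^*=P_{\mathscr{D}_-(L_F)}\},$$ are in bijective correspondence with the $\#F\times\#F$ complex matrices $(M_{\alpha,\beta})_{(\alpha,\beta)\in F\times F}$ satisfying $$\sum_{\gamma\in F}\sum_{\xi\in F}\overline{M_{\gamma,\alpha}}\,Z(\gamma-\xi)\,M_{\xi,\beta}=Z(\alpha-\beta)\qquad\text{for all }(\alpha,\beta)\in F\times F .$$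
   Context: $\mathbb{D}$ is the open unit disk, $\mathbb{T}=\partial\mathbb{D}$, $e(x)=e^{i2\pi x}$; a point $e(\theta)\in\mathbb{T}$ is identified with its angular variable $\theta\in\mathbb{R}/\mathbb{Z}$. $\mathscr{H}_2$ is the Hardy space of analytic functions $f(z)=\sum_{k\ge0}x_kz^k$ on $\mathbb{D}$ with $\|f\|^2=\sum|x_k|^2<\infty$. $H=z\frac{d}{dz}$ is the selfadjoint operator with domain $\mathscr{D}(H)=\{f\in\mathscr{H}_2: z\frac{d}{dz}f\in\mathscr{H}_2\}$; for $f\in\mathscr{D}(H)$ the Taylor coefficients are absolutely summable, and $\tilde f$ is the continuous extension of $f$ to $\overline{\mathbb{D}}$. $Z(x)=\sum_{n=0}^\infty\frac{e(nx)}{1+n^2}$. $\mathscr{D}_\pm(L_F)=\{f\in\mathscr{D}(L_F^* ):L_F^*f=\pm if\}$, and $P_{\mathscr{D}_\pm(L_F)}$ are the orthogonal projections onto them. (By von Neumann's theorem the elements of $\mathscr{C}(L_F)$ parametrize the selfadjoint extensions of $L_F$.) *)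

theory Defs
  imports "HOL-Complex_Analysis.Complex_Analysis" "HOL-Library.FuncSet"
begin

definition taylor_coeff :: "(complex \<Rightarrow> complex) \<Rightarrow> nat \<Rightarrow> complex" where
  "taylor_coeff f k = (deriv ^^ k) f 0 / fact k"

text \<open>A function on the open disk is represented by its extension by 0 to the whole plane, so
  that equality in the Hardy space is equality of HOL functions and the pointwise linear
  structure is the one of functions on the disk.\<close>

definition hardy2 :: "(complex \<Rightarrow> complex) set" where
  "hardy2 = {f. f holomorphic_on ball 0 1 \<and> (\<forall>z. z \<notin> ball 0 1 \<longrightarrow> f z = 0)
               \<and> summable (\<lambda>k. (cmod (taylor_coeff f k))\<^sup>2)}"

text \<open>The inner product polarizing the Hardy norm, conjugate-linear in the first argument.\<close>

definition hinner :: "(complex \<Rightarrow> complex) \<Rightarrow> (complex \<Rightarrow> complex) \<Rightarrow> complex" where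
  "hinner f g = (\<Sum>k. cnj (taylor_coeff f k) * taylor_coeff g k)"

definition hnorm :: "(complex \<Rightarrow> complex) \<Rightarrow> real" where
  "hnorm f = sqrt (\<Sum>k. (cmod (taylor_coeff f k))\<^sup>2)"

text \<open>The operator $z\,d/dz$. The case distinction maintains the convention of vanishing off the
  disk: on the unit circle the value of \<^const>\<open>deriv\<close> would be arbitrary.\<close>

definition euler_op :: "(complex \<Rightarrow> complex) \<Rightarrow> complex \<Rightarrow> complex" where
  "euler_op f z = (if z \<in> ball 0 1 then z * deriv f z else 0)"

definition dom_H :: "(complex \<Rightarrow> complex) set" where
  "dom_H = {f \<in> hardy2. euler_op f \<in> hardy2}"

text \<open>The continuous extension to the closed disk; meaningful for the elements of
  \<open>dom_H\<close>, whose Taylor coefficients are absolutely summable.\<close>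

definition cont_ext :: "(complex \<Rightarrow> complex) \<Rightarrow> complex \<Rightarrow> complex" where
  "cont_ext f z = Lim (at z within ball 0 1) f"

definition dom_L :: "complex set \<Rightarrow> (complex \<Rightarrow> complex) set" where
  "dom_L F = {f \<in> dom_H. \<forall>\<zeta>\<in>F. cont_ext f \<zeta> = 0}"

text \<open>The Hilbert space adjoint of an operator \<open>T\<close> with domain \<open>D\<close>. The value
  \<open>adj_op D T f\<close> is determined for \<open>f \<in> adj_dom D T\<close> when \<open>D\<close> is dense in the Hardy space.\<close>

definition adj_dom ::
  "(complex \<Rightarrow> complex) set \<Rightarrow> ((complex \<Rightarrow> complex) \<Rightarrow> complex \<Rightarrow> complex) \<Rightarrow> (complex \<Rightarrow> complex) set"
  where
  "adj_dom D T = {f \<in> hardy2. \<exists>g\<in>hardy2. \<forall>h\<in>D. hinner f (T h) = hinner g h}"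

definition adj_op ::
  "(complex \<Rightarrow> complex) set \<Rightarrow> ((complex \<Rightarrow> complex) \<Rightarrow> complex \<Rightarrow> complex)
     \<Rightarrow> (complex \<Rightarrow> complex) \<Rightarrow> complex \<Rightarrow> complex"
  where
  "adj_op D T f = (THE g. g \<in> hardy2 \<and> (\<forall>h\<in>D. hinner f (T h) = hinner g h))"

definition deficiency_plus :: "complex set \<Rightarrow> (complex \<Rightarrow> complex) set" where
  "deficiency_plus F =
     {f \<in> adj_dom (dom_L F) euler_op. adj_op (dom_L F) euler_op f = (\<lambda>z. \<i> * f z)}"

definition deficiency_minus :: "complex set \<Rightarrow> (complex \<Rightarrow> complex) set" where
  "deficiency_minus F =
     {f \<in> adj_dom (dom_L F) euler_op. adj_op (dom_L F) euler_op f = (\<lambda>z. - \<i> * f z)}"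

definition orth_proj ::
  "(complex \<Rightarrow> complex) set \<Rightarrow> (complex \<Rightarrow> complex) \<Rightarrow> complex \<Rightarrow> complex" where
  "orth_proj S f = (THE p. p \<in> S \<and> (\<forall>s\<in>S. hinner s (\<lambda>z. f z - p z) = 0))"

definition bounded_op :: "((complex \<Rightarrow> complex) \<Rightarrow> complex \<Rightarrow> complex) \<Rightarrow> bool" where
  "bounded_op U \<longleftrightarrow>
     U \<in> hardy2 \<rightarrow>\<^sub>E hardy2 \<and>
     (\<forall>f\<in>hardy2. \<forall>g\<in>hardy2. U (\<lambda>z. f z + g z) = (\<lambda>z. U f z + U g z)) \<and>
     (\<forall>c. \<forall>f\<in>hardy2. U (\<lambda>z. c * f z) = (\<lambda>z. c * U f z)) \<and>
     (\<exists>C. \<forall>f\<in>hardy2. hnorm (U f) \<le> C * hnorm f)"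

text \<open>A partial isometry from one deficiency space to the other is an operator on the whole Hardy
  space (vanishing on the orthogonal complement of its initial space), which is what makes
  $U^*U$ and $UU^*$ comparable with the two projections.\<close>

definition deficiency_isometries :: "complex set \<Rightarrow> ((complex \<Rightarrow> complex) \<Rightarrow> complex \<Rightarrow> complex) set"
  where
  "deficiency_isometries F =
     {U. bounded_op U \<and> U ` deficiency_plus F \<subseteq> deficiency_minus F \<and>
         (\<forall>f\<in>hardy2. adj_op hardy2 U (U f) = orth_proj (deficiency_plus F) f) \<and>
         (\<forall>f\<in>hardy2. U (adj_op hardy2 U f) = orth_proj (deficiency_minus F) f)}"

definition e :: "real \<Rightarrow> complex" where
  "e x = exp (\<i> * of_real (2 * pi * x))"

text \<open>The representative in $[0,1)$ of the angular variable of a point of the unit circle.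
  As \<open>Z\<close> below has period 1, the choice of representative is immaterial.\<close>

definition angle :: "complex \<Rightarrow> real" where
  "angle \<zeta> = Arg2pi \<zeta> / (2 * pi)"

definition Z :: "real \<Rightarrow> complex" where
  "Z x = (\<Sum>n. e (real n * x) / of_real (1 + (real n)\<^sup>2))"

text \<open>For $|\zeta| = 1$ and $\lambda = \pm i$ this is the solution, with Taylor coefficients
  $\overline{\zeta}^n/(n-\lambda)$, of $L_F^* f = \lambda f$ associated with a point $\zeta \in F$;
  letting $\zeta$ range over \<open>F\<close> gives the natural basis of the deficiency space.\<close>

definition deficiency_vector :: "complex \<Rightarrow> complex \<Rightarrow> complex \<Rightarrow> complex" where
  "deficiency_vector l \<zeta> z =
     (if z \<in> ball 0 1 then (\<Sum>n. (cnj \<zeta> * z) ^ n / (of_nat n - l)) else 0)"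

text \<open>Matrices indexed by \<open>F \<times> F\<close>, as functions fixed to \<open>undefined\<close> off \<open>F \<times> F\<close>.\<close>

definition Z_isometric_matrices :: "complex set \<Rightarrow> (complex \<times> complex \<Rightarrow> complex) set" where
  "Z_isometric_matrices F =
     {M \<in> F \<times> F \<rightarrow>\<^sub>E UNIV. \<forall>\<alpha>\<in>F. \<forall>\<beta>\<in>F.
        (\<Sum>\<gamma>\<in>F. \<Sum>\<xi>\<in>F. cnj (M (\<gamma>, \<alpha>)) * Z (angle \<gamma> - angle \<xi>) * M (\<xi>, \<beta>))
          = Z (angle \<alpha> - angle \<beta>)}"

end

theory Submission
  imports Defs "HOL-Library.Function_Algebras"
begin

text \<open>
  Identify a function with its square-summable sequence of Taylor coefficients. The Euler operator
  \<open>H\<close> then multiplies the \<open>k\<close>-th coefficient by \<open>k\<close>, and \<open>H - l\<close> is inverted, for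
  \<open>l \<notin> \<nat>\<close>, by a coefficientwise division, the resolvent. The point of passing to the
  resolvent is that evaluation of the continuous extension at \<open>\<zeta> \<in> F\<close>, composed with the
  resolvent at \<open>cnj l\<close>, is the inner product with the deficiency vector
  \<open>v\<^sub>\<zeta>\<close>, which has the coefficients \<open>cnj \<zeta> ^ k / (k - l)\<close> (\<open>cont_ext_resolvent\<close>).
  So the domain of \<open>L\<^sub>F\<close> corresponds to the orthogonal complement of the finitely many vectors
  \<open>v\<^sub>\<zeta>\<close>, and the solutions of \<open>L\<^sub>F\<^sup>* f = l f\<close> are the double orthogonal
  complement of these vectors, that is, their span (\<open>deficiency_space_eq_span\<close>). For the adjoint
  to be well defined the domain has to be dense (\<open>dom_L_dense\<close>); this, like the linear
  independence of the \<open>v\<^sub>\<zeta>\<close>, holds because a finite sum \<open>\<Sum>\<zeta>. c \<zeta> * cnj \<zeta> ^ k\<close> with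
  distinct frequencies on the circle tends to \<open>0\<close> only if it is trivial
  (\<open>exponential_sum_tendsto_0\<close>).

  The two deficiency spaces thus have explicit bases indexed by \<open>F\<close>, and both bases have the
  Gram matrix \<open>Z (\<alpha> - \<beta>)\<close> (\<open>hinner_deficiency_vector\<close>). A linear map between the spaces is
  a matrix \<open>M\<close>, and the matrix equation says precisely that the map preserves the Gram matrix,
  that is, that it is isometric; by equality of dimensions it is then unitary. Extending by \<open>0\<close>
  on the orthogonal complement gives a partial isometry with the two required projections
  (\<open>matrix_represents_isometry\<close>). Conversely, a partial isometry vanishes on the complement, so it
  is determined by its matrix (\<open>represents_unique_isometry\<close>), and \<open>U\<^sup>* U = P\<close> gives the
  matrix equation (\<open>deficiency_isometry_represented\<close>). The adjoint of an arbitrary bounded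
  operator is defined by a description, so its existence has to be supplied by the Riesz
  representation theorem (\<open>riesz_representation\<close>).
\<close>

section \<open>Square-summable sequences and the Hardy space\<close>

definition cscale :: "complex \<Rightarrow> (complex \<Rightarrow> complex) \<Rightarrow> complex \<Rightarrow> complex" where
  "cscale c f = (\<lambda>z. c * f z)"

lemma cscale_apply [simp]: "cscale c f z = c * f z"
  by (simp add: cscale_def)

interpretation fs: vector_space cscale
  by unfold_locales (auto simp: fun_eq_iff algebra_simps)

interpretation fs_pair: vector_space_pair cscale cscale ..

lemma sum_fun_apply: "(\<Sum>i\<in>A. f i) x = (\<Sum>i\<in>A. f i x)"
  by (induction A rule: infinite_finite_induct) auto

definition sq_summable :: "(nat \<Rightarrow> complex) \<Rightarrow> bool" where
  "sq_summable a \<longleftrightarrow> summable (\<lambda>k. (cmod (a k))\<^sup>2)"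

lemma sq_summable_mult:
  assumes "sq_summable a" "sq_summable b"
  shows "summable (\<lambda>k. cmod (a k) * cmod (b k))"
proof (rule summable_comparison_test')
  show "summable (\<lambda>k. (cmod (a k))\<^sup>2 + (cmod (b k))\<^sup>2)"
    using assms by (auto simp: sq_summable_def intro: summable_add)
  have "x * y \<le> x\<^sup>2 + y\<^sup>2" if "x \<ge> 0" "y \<ge> 0" for x y :: real
    using sum_squares_bound[of x y] that mult_nonneg_nonneg[OF that] by linarith
  then show "norm (cmod (a n) * cmod (b n)) \<le> (cmod (a n))\<^sup>2 + (cmod (b n))\<^sup>2" for n
    by simp
qed

lemma sq_summable_bound:
  assumes "sq_summable a" "\<And>k. cmod (b k) \<le> C * cmod (a k)"
  shows "sq_summable b"
  unfolding sq_summable_def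
proof (rule summable_comparison_test')
  show "summable (\<lambda>k. C\<^sup>2 * (cmod (a k))\<^sup>2)"
    using assms(1) by (auto simp: sq_summable_def intro: summable_mult)
  show "norm ((cmod (b n))\<^sup>2) \<le> C\<^sup>2 * (cmod (a n))\<^sup>2" for n
    using power_mono[OF assms(2)[of n], of 2] by (simp add: power_mult_distrib)
qed

lemma sq_summable_scale: "sq_summable a \<Longrightarrow> sq_summable (\<lambda>k. c * a k)"
  by (erule sq_summable_bound[where C = "cmod c"]) (simp add: norm_mult)

lemma sq_summable_add:
  assumes "sq_summable a" "sq_summable b"
  shows "sq_summable (\<lambda>k. a k + b k)"
  unfolding sq_summable_def
proof (rule summable_comparison_test')
  show "summable (\<lambda>k. 2 * ((cmod (a k))\<^sup>2 + (cmod (b k))\<^sup>2))"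
    using assms by (intro summable_mult summable_add) (auto simp: sq_summable_def)
  fix n
  have "(cmod (a n + b n))\<^sup>2 \<le> (cmod (a n) + cmod (b n))\<^sup>2"
    by (intro power_mono norm_triangle_ineq) auto
  also have "\<dots> \<le> 2 * ((cmod (a n))\<^sup>2 + (cmod (b n))\<^sup>2)"
    using sum_squares_bound[of "cmod (a n)" "cmod (b n)"] by (simp add: power2_sum)
  finally show "norm ((cmod (a n + b n))\<^sup>2) \<le> 2 * ((cmod (a n))\<^sup>2 + (cmod (b n))\<^sup>2)"
    by simp
qed

lemma sq_summable_tendsto_0: "sq_summable a \<Longrightarrow> a \<longlonglongrightarrow> 0"
  using tendsto_real_sqrt[OF summable_LIMSEQ_zero[of "\<lambda>k. (cmod (a k))\<^sup>2"]]
  by (simp add: sq_summable_def tendsto_norm_zero_iff)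

lemma sq_summable_inverse_Suc: "sq_summable (\<lambda>n. complex_of_real (inverse (real (Suc n))))"
proof -
  have "summable (\<lambda>n. inverse (real n ^ 2))"
    by (rule inverse_power_summable) simp
  then have "summable (\<lambda>n. inverse (real (Suc n) ^ 2))"
    by (subst summable_Suc_iff)
  then show ?thesis
    by (simp only: sq_summable_def norm_of_real power2_abs power_inverse)
qed

text \<open>The quotient \<open>(k + 1) / (k - l)\<close> tends to \<open>1\<close>, hence is bounded. This one estimate makes
  \<open>1 / (k - l)\<close> square-summable and turns division of Taylor coefficients by \<open>k - l\<close> into
  a map from the Hardy space to the domain of the Euler operator.\<close>

lemma norm_shift_ge:
  fixes l :: complex
  assumes "l \<notin> \<nat>"
  obtains C where "C > 0" "\<And>k. real k + 1 \<le> C * cmod (of_nat k - l)"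
proof -
  have nz: "of_nat k - l \<noteq> 0" for k
    using assms by (metis eq_iff_diff_eq_0 of_nat_in_Nats)
  have "filterlim (\<lambda>k. of_nat k + (- l)) at_infinity sequentially"
    by (intro tendsto_add_filterlim_at_infinity'[OF tendsto_of_nat tendsto_const])
  then have "(\<lambda>k. 1 + (1 + l) / (of_nat k - l)) \<longlonglongrightarrow> 1 + 0"
    by (intro tendsto_add tendsto_const tendsto_divide_0[OF tendsto_const]) auto
  then have "Bseq (\<lambda>k. 1 + (1 + l) / (of_nat k - l))"
    by (rule convergent_imp_Bseq[OF convergentI])
  then obtain C where C: "C > 0" "\<And>k. cmod (1 + (1 + l) / (of_nat k - l)) \<le> C"
    by (auto elim: BseqE)
  have "real k + 1 \<le> C * cmod (of_nat k - l)" for k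
  proof -
    have "1 + (1 + l) / (of_nat k - l) = (of_nat k + 1) / (of_nat k - l)"
      using nz[of k] by (simp add: field_simps)
    then have "cmod (of_nat (Suc k)) / cmod (of_nat k - l) \<le> C"
      using C(2)[of k] by (simp add: norm_divide add.commute)
    then show ?thesis
      using nz[of k] by (simp only: norm_of_nat) (simp add: field_simps)
  qed
  then show thesis using that C(1) by blast
qed

lemma hardy2_iff:
  "f \<in> hardy2 \<longleftrightarrow> f holomorphic_on ball 0 1 \<and> (\<forall>z. z \<notin> ball 0 1 \<longrightarrow> f z = 0)
               \<and> sq_summable (taylor_coeff f)"
  by (simp add: hardy2_def sq_summable_def)

lemma taylor_coeff_eqI: "f has_fps_expansion G \<Longrightarrow> taylor_coeff f k = fps_nth G k"
  by (simp add: fps_nth_fps_expansion taylor_coeff_def)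

lemma hardy2_has_fps_expansion:
  assumes "f \<in> hardy2"
  shows "f has_fps_expansion Abs_fps (taylor_coeff f)"
proof -
  have "f has_fps_expansion fps_expansion f 0"
    using assms by (intro has_fps_expansion_fps_expansion[of "ball 0 1"]) (auto simp: hardy2_iff)
  also have "fps_expansion f 0 = Abs_fps (taylor_coeff f)"
    by (simp add: fps_expansion_def taylor_coeff_def [abs_def])
  finally show ?thesis .
qed

lemma taylor_coeff_add:
  assumes "f \<in> hardy2" "g \<in> hardy2"
  shows "taylor_coeff (f + g) k = taylor_coeff f k + taylor_coeff g k"
  using taylor_coeff_eqI[OF has_fps_expansion_add[OF assms[THEN hardy2_has_fps_expansion]]]
  by (simp add: plus_fun_def)

lemma taylor_coeff_scale:
  assumes "f \<in> hardy2"
  shows "taylor_coeff (cscale c f) k = c * taylor_coeff f k"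
  using taylor_coeff_eqI[OF has_fps_expansion_cmult_left[OF hardy2_has_fps_expansion[OF assms], of c]]
  by (simp add: cscale_def)

lemma taylor_coeff_zero [simp]: "taylor_coeff 0 k = 0"
  using taylor_coeff_eqI[OF has_fps_expansion_0] by (simp add: zero_fun_def)

lemma subspace_hardy2: "fs.subspace hardy2"
  unfolding fs.subspace_def
proof (intro conjI ballI allI)
  show "0 \<in> hardy2"
    using taylor_coeff_zero by (simp add: hardy2_iff sq_summable_def) (simp add: zero_fun_def)
next
  fix f g assume "f \<in> hardy2" "g \<in> hardy2"
  then show "f + g \<in> hardy2"
    using sq_summable_add[of "taylor_coeff f" "taylor_coeff g"] taylor_coeff_add[of f g]
    by (simp add: hardy2_iff sq_summable_def) (simp add: plus_fun_def holomorphic_on_add)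
next
  fix c f assume "f \<in> hardy2"
  then show "cscale c f \<in> hardy2"
    using sq_summable_scale[of "taylor_coeff f" c] taylor_coeff_scale[of f c]
    by (simp add: hardy2_iff sq_summable_def) (simp add: cscale_def holomorphic_on_mult)
qed

lemmas hardy2_zero = fs.subspace_0[OF subspace_hardy2]
  and hardy2_add = fs.subspace_add[OF subspace_hardy2]
  and hardy2_diff = fs.subspace_diff[OF subspace_hardy2]
  and hardy2_scale = fs.subspace_scale[OF subspace_hardy2]
  and hardy2_sum = fs.subspace_sum[OF subspace_hardy2]

lemma taylor_coeff_diff:
  assumes "f \<in> hardy2" "g \<in> hardy2"
  shows "taylor_coeff (f - g) k = taylor_coeff f k - taylor_coeff g k"
  using taylor_coeff_add[OF hardy2_diff[OF assms] assms(2), of k] by simp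

lemma taylor_coeff_sum:
  assumes "\<And>i. i \<in> A \<Longrightarrow> f i \<in> hardy2"
  shows "taylor_coeff (\<Sum>i\<in>A. f i) k = (\<Sum>i\<in>A. taylor_coeff (f i) k)"
  using assms
  by (induction A rule: infinite_finite_induct) (auto simp: taylor_coeff_add hardy2_sum)

lemma hardy2_sums:
  assumes "f \<in> hardy2" "z \<in> ball 0 1"
  shows "(\<lambda>k. taylor_coeff f k * z ^ k) sums f z"
  using holomorphic_power_series[of f 0 1 z] assms by (simp add: hardy2_iff taylor_coeff_def)

lemma hardy2_eqI:
  assumes "f \<in> hardy2" "g \<in> hardy2" "\<And>k. taylor_coeff f k = taylor_coeff g k"
  shows "f = g"
proof
  fix z show "f z = g z"
  proof (cases "z \<in> ball 0 1")
    case True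
    then show ?thesis
      using hardy2_sums[of f z] hardy2_sums[of g z] assms by (simp add: sums_iff)
  next
    case False
    then show ?thesis using assms by (auto simp: hardy2_iff)
  qed
qed

text \<open>The inverse of the passage to Taylor coefficients: together with \<open>hardy2_eqI\<close> it
  identifies the Hardy space with the square-summable sequences, and all operators below are
  computed there coefficientwise.\<close>

definition of_coeffs :: "(nat \<Rightarrow> complex) \<Rightarrow> complex \<Rightarrow> complex" where
  "of_coeffs a z = (if z \<in> ball 0 1 then (\<Sum>k. a k * z ^ k) else 0)"

lemma
  assumes "sq_summable a"
  shows of_coeffs_hardy2: "of_coeffs a \<in> hardy2"
    and taylor_coeff_of_coeffs: "taylor_coeff (of_coeffs a) k = a k"
proof -
  obtain C where C: "\<And>k. cmod (a k) \<le> C"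
    using BseqE[OF convergent_imp_Bseq[OF convergentI[OF sq_summable_tendsto_0[OF assms]]]]
    by metis
  define G where "G = Abs_fps a"
  have rad: "fps_conv_radius G \<ge> 1"
    unfolding fps_conv_radius_def
  proof (rule conv_radius_geI_ex')
    fix r :: real assume r: "0 < r" "ereal r < 1"
    then have "summable (\<lambda>n. C * r ^ n)"
      by (intro summable_mult summable_geometric) auto
    then show "summable (\<lambda>n. fps_nth G n * of_real r ^ n)"
      by (rule summable_comparison_test')
         (use r C in \<open>auto simp: G_def norm_mult norm_power intro!: mult_mono\<close>)
  qed
  have ev: "eval_fps G z = of_coeffs a z" if "z \<in> ball 0 1" for z
    using that by (simp add: eval_fps_def of_coeffs_def G_def)
  have "ball 0 1 \<subseteq> eball (0::complex) (fps_conv_radius G)"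
  proof
    fix z :: complex assume "z \<in> ball 0 1"
    then have "ereal (norm z) < 1" by simp
    then have "ereal (norm z) < fps_conv_radius G" using rad by (rule less_le_trans)
    then show "z \<in> eball 0 (fps_conv_radius G)" by (simp add: in_eball_iff)
  qed
  then have "eval_fps G holomorphic_on ball 0 1"
    by (rule holomorphic_on_eval_fps)
  then have hol: "of_coeffs a holomorphic_on ball 0 1"
    by (rule holomorphic_transform) (use ev in auto)
  have "of_coeffs a has_fps_expansion G"
    unfolding has_fps_expansion_def
  proof
    have "(0::ereal) < 1" by simp
    then show "0 < fps_conv_radius G" using rad by (rule less_le_trans)
    have "\<forall>\<^sub>F z in nhds 0. z \<in> ball (0::complex) 1"
      by (intro eventually_nhds_in_open) auto
    then show "\<forall>\<^sub>F z in nhds 0. eval_fps G z = of_coeffs a z"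
      by eventually_elim (rule ev)
  qed
  then show tc: "taylor_coeff (of_coeffs a) k = a k" for k
    by (simp add: taylor_coeff_eqI G_def)
  then have "taylor_coeff (of_coeffs a) = a" by auto
  then show "of_coeffs a \<in> hardy2"
    using hol assms by (auto simp: hardy2_iff) (auto simp: of_coeffs_def)
qed

lemma taylor_coeff_euler_op:
  assumes "f \<in> hardy2"
  shows "taylor_coeff (euler_op f) k = of_nat k * taylor_coeff f k"
proof -
  define G where "G = Abs_fps (taylor_coeff f)"
  have "(\<lambda>z. z * deriv f z) has_fps_expansion fps_X * fps_deriv G"
    unfolding G_def
    by (intro has_fps_expansion_mult has_fps_expansion_fps_X has_fps_expansion_deriv
        hardy2_has_fps_expansion assms)
  moreover have "\<forall>\<^sub>F z in nhds 0. z \<in> ball (0::complex) 1"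
    by (intro eventually_nhds_in_open) auto
  then have "\<forall>\<^sub>F z in nhds 0. euler_op f z = z * deriv f z"
    by eventually_elim (simp add: euler_op_def)
  ultimately have "euler_op f has_fps_expansion fps_X * fps_deriv G"
    by (subst has_fps_expansion_cong[OF _ refl])
  then show ?thesis
    by (subst taylor_coeff_eqI) (auto simp: G_def)
qed

lemma euler_op_hardy2_iff:
  assumes "f \<in> hardy2"
  shows "euler_op f \<in> hardy2 \<longleftrightarrow> sq_summable (\<lambda>k. of_nat k * taylor_coeff f k)"
proof -
  have "(\<lambda>z. z * deriv f z) holomorphic_on ball 0 1"
    using assms by (intro holomorphic_intros) (auto simp: hardy2_iff)
  then have "euler_op f holomorphic_on ball 0 1"
    by (rule holomorphic_transform) (auto simp: euler_op_def)
  moreover have "taylor_coeff (euler_op f) = (\<lambda>k. of_nat k * taylor_coeff f k)"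
    using taylor_coeff_euler_op[OF assms] by auto
  ultimately show ?thesis
    by (auto simp: hardy2_iff) (auto simp: euler_op_def)
qed

section \<open>The inner product\<close>

lemma hinner_summable:
  assumes "f \<in> hardy2" "g \<in> hardy2"
  shows "summable (\<lambda>k. cnj (taylor_coeff f k) * taylor_coeff g k)"
  using sq_summable_mult[of "taylor_coeff f" "taylor_coeff g"] assms
  by (auto simp: norm_mult hardy2_iff intro: summable_norm_cancel[where 'a = complex])

lemma hinner_commute: "f \<in> hardy2 \<Longrightarrow> g \<in> hardy2 \<Longrightarrow> hinner g f = cnj (hinner f g)"
  using bounded_linear.suminf[OF bounded_linear_cnj hinner_summable[of f g]]
  by (simp add: hinner_def mult.commute)

lemma hinner_add_right:
  assumes "f \<in> hardy2" "g \<in> hardy2" "h \<in> hardy2"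
  shows "hinner f (g + h) = hinner f g + hinner f h"
  unfolding hinner_def using assms
  by (subst suminf_add) (auto simp: hinner_summable taylor_coeff_add distrib_left)

lemma hinner_scale_right:
  assumes "f \<in> hardy2" "g \<in> hardy2"
  shows "hinner f (cscale c g) = c * hinner f g"
  unfolding hinner_def using assms
  by (subst suminf_mult[symmetric]) (auto simp: hinner_summable taylor_coeff_scale mult.left_commute)

lemma hinner_zero_right [simp]: "hinner f 0 = 0"
  by (simp add: hinner_def)

lemma hinner_zero_left [simp]: "hinner 0 f = 0"
  by (simp add: hinner_def)

lemma hinner_add_left:
  assumes "f \<in> hardy2" "g \<in> hardy2" "h \<in> hardy2"
  shows "hinner (g + h) f = hinner g f + hinner h f"
  using assms by (simp add: hinner_commute[of f] hinner_add_right hardy2_add)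

lemma hinner_scale_left:
  assumes "f \<in> hardy2" "g \<in> hardy2"
  shows "hinner (cscale c g) f = cnj c * hinner g f"
  using assms by (simp add: hinner_commute[of f] hinner_scale_right hardy2_scale)

lemma hinner_diff_right:
  assumes "f \<in> hardy2" "g \<in> hardy2" "h \<in> hardy2"
  shows "hinner f (g - h) = hinner f g - hinner f h"
  using hinner_add_right[OF assms(1) hardy2_diff[OF assms(2,3)] assms(3)] by simp

lemma hinner_diff_left:
  assumes "f \<in> hardy2" "g \<in> hardy2" "h \<in> hardy2"
  shows "hinner (g - h) f = hinner g f - hinner h f"
  using hinner_add_left[OF assms(1) hardy2_diff[OF assms(2,3)] assms(3)] by simp

lemma hinner_sum_right:
  assumes "f \<in> hardy2" "\<And>i. i \<in> A \<Longrightarrow> g i \<in> hardy2"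
  shows "hinner f (\<Sum>i\<in>A. g i) = (\<Sum>i\<in>A. hinner f (g i))"
  using assms(2)
  by (induction A rule: infinite_finite_induct) (auto simp: assms(1) hinner_add_right hardy2_sum)

lemma hinner_sum_left:
  assumes "f \<in> hardy2" "\<And>i. i \<in> A \<Longrightarrow> g i \<in> hardy2"
  shows "hinner (\<Sum>i\<in>A. g i) f = (\<Sum>i\<in>A. hinner (g i) f)"
  using assms(2)
  by (induction A rule: infinite_finite_induct) (auto simp: assms(1) hinner_add_left hardy2_sum)

lemma hinner_lincomb:
  assumes "\<And>i. i \<in> A \<Longrightarrow> x i \<in> hardy2" "\<And>j. j \<in> B \<Longrightarrow> y j \<in> hardy2"
  shows "hinner (\<Sum>i\<in>A. cscale (a i) (x i)) (\<Sum>j\<in>B. cscale (b j) (y j)) =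
           (\<Sum>i\<in>A. \<Sum>j\<in>B. cnj (a i) * hinner (x i) (y j) * b j)"
  using assms
  by (simp add: hinner_sum_left hinner_sum_right hinner_scale_left hinner_scale_right
      hardy2_sum hardy2_scale sum_distrib_left ac_simps) (rule sum.swap)

lemma hinner_self:
  assumes "f \<in> hardy2"
  shows "hinner f f = of_real ((hnorm f)\<^sup>2)"
proof -
  have sm: "summable (\<lambda>k. (cmod (taylor_coeff f k))\<^sup>2)"
    using assms by (simp add: hardy2_def)
  have "(hnorm f)\<^sup>2 = (\<Sum>k. (cmod (taylor_coeff f k))\<^sup>2)"
    unfolding hnorm_def by (intro real_sqrt_pow2 suminf_nonneg sm) auto
  then have "of_real ((hnorm f)\<^sup>2) = (\<Sum>k. complex_of_real ((cmod (taylor_coeff f k))\<^sup>2))"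
    using bounded_linear.suminf[OF bounded_linear_of_real sm] by metis
  also have "complex_of_real ((cmod c)\<^sup>2) = cnj c * c" for c
    by (subst complex_norm_square) (rule mult.commute)
  then have "(\<Sum>k. complex_of_real ((cmod (taylor_coeff f k))\<^sup>2)) = hinner f f"
    unfolding hinner_def by metis
  finally show ?thesis by (rule sym)
qed

lemma hnorm_nonneg: "f \<in> hardy2 \<Longrightarrow> hnorm f \<ge> 0"
  unfolding hnorm_def hardy2_def by (auto intro!: suminf_nonneg)

lemma hinner_self_eq_0:
  assumes "f \<in> hardy2" "hinner f f = 0"
  shows "f = 0"
proof -
  have sm: "summable (\<lambda>k. (cmod (taylor_coeff f k))\<^sup>2)"
    using assms by (simp add: hardy2_def)
  have "hnorm f = 0" using hinner_self[OF assms(1)] assms(2) by simp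
  then have "taylor_coeff f k = 0" for k
    using suminf_eq_zero_iff[OF sm] by (simp add: hnorm_def)
  then show ?thesis
    by (intro hardy2_eqI assms hardy2_zero) auto
qed

lemma hinner_Cauchy_Schwarz:
  assumes "f \<in> hardy2" "g \<in> hardy2"
  shows "cmod (hinner f g) \<le> hnorm f * hnorm g"
proof -
  let ?f = "\<lambda>k. cmod (taylor_coeff f k)" and ?g = "\<lambda>k. cmod (taylor_coeff g k)"
  have sm: "summable (\<lambda>k. ?f k * ?g k)"
    using assms by (intro sq_summable_mult) (auto simp: hardy2_iff)
  have L2: "L2_set (\<lambda>k. cmod (taylor_coeff h k)) {..<n} \<le> hnorm h" if "h \<in> hardy2" for h n
    using that unfolding L2_set_def hnorm_def hardy2_def
    by (intro real_sqrt_le_mono sum_le_suminf) auto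
  have "cmod (hinner f g) \<le> (\<Sum>k. norm (cnj (taylor_coeff f k) * taylor_coeff g k))"
    unfolding hinner_def using sm by (intro summable_norm) (simp add: norm_mult)
  also have "\<dots> = (\<Sum>k. ?f k * ?g k)" by (simp add: norm_mult)
  also have "\<dots> \<le> hnorm f * hnorm g"
  proof (rule suminf_le_const[OF sm])
    fix n
    have "(\<Sum>k<n. ?f k * ?g k) \<le> L2_set ?f {..<n} * L2_set ?g {..<n}"
      using L2_set_mult_ineq[of ?f ?g "{..<n}"] by simp
    also have "\<dots> \<le> hnorm f * hnorm g"
      using L2 assms by (intro mult_mono) (auto simp: hnorm_nonneg)
    finally show "(\<Sum>k<n. ?f k * ?g k) \<le> hnorm f * hnorm g" .
  qed
  finally show ?thesis .
qed

section \<open>Orthogonal projections onto finite-dimensional subspaces\<close>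

lemma span_subset_hardy2: "B \<subseteq> hardy2 \<Longrightarrow> fs.span B \<subseteq> hardy2"
  by (rule fs.span_minimal[OF _ subspace_hardy2])

text \<open>One step of Gram--Schmidt: to enlarge the subspace by \<open>b\<close>, correct the projection by the
  component along the part \<open>r\<close> of \<open>b\<close> orthogonal to the old subspace. When \<open>b\<close> already lies
  in it, \<open>r = 0\<close> and the coefficient \<open>c\<close> is \<open>0 / 0 = 0\<close>, which is the right value:
  so the family \<open>B\<close> may be dependent.\<close>

lemma orthogonal_projection_exists:
  assumes "finite B" "B \<subseteq> hardy2" "f \<in> hardy2"
  shows "\<exists>p\<in>fs.span B. \<forall>s\<in>fs.span B. hinner s (f - p) = 0"
  using assms
proof (induction B arbitrary: f)
  case empty
  show "\<exists>p\<in>fs.span {}. \<forall>s\<in>fs.span {}. hinner s (f - p) = 0" by simp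
next
  case (insert b B)
  have IH: "\<exists>p\<in>fs.span B. \<forall>s\<in>fs.span B. hinner s (g - p) = 0" if "g \<in> hardy2" for g
    using insert.prems that by (intro insert.IH) auto
  have B: "fs.span B \<subseteq> hardy2" using insert.prems by (intro span_subset_hardy2) auto
  have b: "b \<in> hardy2" using insert.prems by auto
  obtain q where q: "q \<in> fs.span B" "\<And>s. s \<in> fs.span B \<Longrightarrow> hinner s (b - q) = 0"
    using IH[OF b] by blast
  obtain p where p: "p \<in> fs.span B" "\<And>s. s \<in> fs.span B \<Longrightarrow> hinner s (f - p) = 0"
    using IH[of f] insert.prems by blast
  define r where "r = b - q"
  define c where "c = hinner r f / hinner r r"
  have H: "f \<in> hardy2" "p \<in> hardy2" "r \<in> hardy2" "f - p \<in> hardy2" "cscale c r \<in> hardy2"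
    using B b p q insert.prems unfolding r_def
    by (auto intro: hardy2_diff hardy2_scale)
  have sub: "x \<in> fs.span (insert b B)" if "x \<in> fs.span B" for x
    using that fs.span_mono[of B "insert b B"] by auto
  have r_span: "r \<in> fs.span (insert b B)"
    unfolding r_def by (rule fs.span_diff[OF fs.span_base sub[OF q(1)]]) simp
  have rs: "hinner s r = 0" if "s \<in> fs.span B" for s
    using q(2)[OF that] by (simp add: r_def)
  have rp: "hinner r p = 0"
    using rs[OF p(1)] hinner_commute[of p r] H by simp
  have crr: "c * hinner r r = hinner r f"
    using hinner_self_eq_0[of r] H by (cases "hinner r r = 0") (auto simp: c_def)
  show "\<exists>p\<in>fs.span (insert b B). \<forall>s\<in>fs.span (insert b B). hinner s (f - p) = 0"
  proof (intro bexI ballI)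
    show "p + cscale c r \<in> fs.span (insert b B)"
      by (intro fs.span_add sub p fs.span_scale r_span)
    fix s assume "s \<in> fs.span (insert b B)"
    then obtain k where k: "s - cscale k b \<in> fs.span B"
      by (auto simp: fs.span_insert)
    define t where "t = s - cscale k r"
    have "t = (s - cscale k b) + cscale k q"
      by (simp add: t_def r_def fs.scale_right_diff_distrib)
    then have t: "t \<in> fs.span B"
      using k q(1) by (auto intro: fs.span_add fs.span_scale)
    then have tH: "t \<in> hardy2" using B by auto
    have "hinner s (f - (p + cscale c r)) = hinner (t + cscale k r) ((f - p) - cscale c r)"
      by (simp add: t_def diff_diff_add)
    also have "\<dots> = hinner t (f - p) - c * hinner t r
        + cnj k * (hinner r f - hinner r p - c * hinner r r)"
      using H tH by (simp add: hinner_add_left hinner_diff_right hinner_scale_left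
          hinner_scale_right hardy2_scale hardy2_diff) (simp add: algebra_simps)
    also have "\<dots> = 0"
      using p(2)[OF t] rs[OF t] rp crr by simp
    finally show "hinner s (f - (p + cscale c r)) = 0" .
  qed
qed

lemma orth_proj_eqI:
  assumes "fs.subspace S" "S \<subseteq> hardy2" "f \<in> hardy2"
    and "p \<in> S" "\<And>s. s \<in> S \<Longrightarrow> hinner s (f - p) = 0"
  shows "orth_proj S f = p"
proof -
  have "orth_proj S f = (THE p. p \<in> S \<and> (\<forall>s\<in>S. hinner s (f - p) = 0))"
    by (simp add: orth_proj_def fun_diff_def)
  also have "\<dots> = p"
  proof (rule the_equality)
    fix q assume q: "q \<in> S \<and> (\<forall>s\<in>S. hinner s (f - q) = 0)"
    have "q - p \<in> S" using q assms by (auto intro: fs.subspace_diff)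
    then have "hinner (q - p) ((f - p) - (f - q)) = 0"
      using assms q by (subst hinner_diff_right) (auto intro!: hardy2_diff)
    then have "hinner (q - p) (q - p) = 0" by simp
    then show "q = p"
      using hinner_self_eq_0[of "q - p"] assms \<open>q - p \<in> S\<close> by auto
  qed (use assms in auto)
  finally show ?thesis .
qed

lemma
  assumes "finite B" "B \<subseteq> hardy2" "f \<in> hardy2"
  shows orth_proj_in_span: "orth_proj (fs.span B) f \<in> fs.span B"
    and orth_proj_orthogonal: "s \<in> fs.span B \<Longrightarrow> hinner s (f - orth_proj (fs.span B) f) = 0"
proof -
  obtain p where p: "p \<in> fs.span B" "\<And>s. s \<in> fs.span B \<Longrightarrow> hinner s (f - p) = 0"
    using orthogonal_projection_exists[OF assms] by auto
  have "orth_proj (fs.span B) f = p"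
    using assms p by (intro orth_proj_eqI span_subset_hardy2) auto
  then show "orth_proj (fs.span B) f \<in> fs.span B"
    and "s \<in> fs.span B \<Longrightarrow> hinner s (f - orth_proj (fs.span B) f) = 0"
    using p by auto
qed

lemma orth_proj_id:
  assumes "B \<subseteq> hardy2" "f \<in> fs.span B"
  shows "orth_proj (fs.span B) f = f"
  using assms span_subset_hardy2[of B] by (intro orth_proj_eqI) auto

lemma hinner_orth_proj_right:
  assumes "finite B" "B \<subseteq> hardy2" "f \<in> hardy2" "s \<in> fs.span B"
  shows "hinner s (orth_proj (fs.span B) f) = hinner s f"
proof -
  have "s \<in> hardy2" "orth_proj (fs.span B) f \<in> hardy2"
    using assms span_subset_hardy2[of B] orth_proj_in_span[of B f] by auto
  then show ?thesis
    using orth_proj_orthogonal[OF assms] assms(3) by (simp add: hinner_diff_right)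
qed

lemma
  assumes "finite B" "B \<subseteq> hardy2" "f \<in> hardy2"
  shows orth_proj_add: "g \<in> hardy2 \<Longrightarrow>
      orth_proj (fs.span B) (f + g) = orth_proj (fs.span B) f + orth_proj (fs.span B) g"
    and orth_proj_scale: "orth_proj (fs.span B) (cscale c f) = cscale c (orth_proj (fs.span B) f)"
proof -
  let ?P = "orth_proj (fs.span B)"
  have H: "s \<in> hardy2" if "s \<in> fs.span B" for s
    using that span_subset_hardy2[OF assms(2)] by auto
  note P = orth_proj_in_span[OF assms(1,2)]
  show "?P (f + g) = ?P f + ?P g" if g: "g \<in> hardy2"
    using assms g P H
    by (intro orth_proj_eqI)
       (auto simp: hinner_diff_right hinner_add_right hinner_orth_proj_right hardy2_add
         intro!: fs.span_add)
  show "?P (cscale c f) = cscale c (?P f)"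
    using assms P H
    by (intro orth_proj_eqI)
       (auto simp: hinner_diff_right hinner_scale_right hinner_orth_proj_right hardy2_scale
         intro!: fs.span_scale)
qed

lemma hnorm_orth_proj_le:
  assumes "finite B" "B \<subseteq> hardy2" "f \<in> hardy2"
  shows "hnorm (orth_proj (fs.span B) f) \<le> hnorm f"
proof -
  let ?p = "orth_proj (fs.span B) f"
  have p: "?p \<in> fs.span B" by (rule orth_proj_in_span[OF assms])
  then have pH: "?p \<in> hardy2" using span_subset_hardy2[OF assms(2)] by auto
  have "complex_of_real ((hnorm ?p)\<^sup>2) = hinner ?p f"
    using hinner_orth_proj_right[OF assms p] hinner_self[OF pH] by simp
  then have "(hnorm ?p)\<^sup>2 = cmod (hinner ?p f)"
    by (metis norm_of_real abs_of_nonneg zero_le_power2)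
  also have "\<dots> \<le> hnorm ?p * hnorm f"
    by (rule hinner_Cauchy_Schwarz[OF pH assms(3)])
  finally have "hnorm ?p * hnorm ?p \<le> hnorm ?p * hnorm f"
    by (simp add: power2_eq_square)
  then show ?thesis
    using hnorm_nonneg[OF pH] hnorm_nonneg[OF assms(3)]
    by (cases "hnorm ?p = 0") (auto simp: mult_le_cancel_left)
qed

text \<open>The vector \<open>u = f - P f\<close> is orthogonal to \<open>B\<close>, hence to \<open>f\<close> and to
  \<open>P f\<close>, hence to itself. Below this turns the defining condition of an adjoint eigenvector,
  an orthogonality to everything that kills finitely many functionals, into membership in a
  finite-dimensional span.\<close>

lemma double_orthogonal_complement_subset_span:
  assumes "finite B" "B \<subseteq> hardy2" "f \<in> hardy2"
    and perp: "\<And>u. u \<in> hardy2 \<Longrightarrow> (\<And>b. b \<in> B \<Longrightarrow> hinner b u = 0) \<Longrightarrow> hinner f u = 0"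
  shows "f \<in> fs.span B"
proof -
  let ?p = "orth_proj (fs.span B) f"
  have p: "?p \<in> fs.span B" by (rule orth_proj_in_span[OF assms(1-3)])
  then have pH: "?p \<in> hardy2" using span_subset_hardy2[OF assms(2)] by auto
  have u: "f - ?p \<in> hardy2" by (rule hardy2_diff[OF assms(3) pH])
  have "hinner b (f - ?p) = 0" if "b \<in> fs.span B" for b
    by (rule orth_proj_orthogonal[OF assms(1-3) that])
  then have "hinner f (f - ?p) = 0" "hinner ?p (f - ?p) = 0"
    using perp[OF u] p by (auto intro: fs.span_base)
  then have "hinner (f - ?p) (f - ?p) = 0"
    using u assms(3) pH by (subst hinner_diff_left) auto
  then have "f = ?p" using hinner_self_eq_0[OF u] by simp
  then show ?thesis using p by metis
qed

section \<open>Bounded functionals and adjoints\<close>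

definition disk_monomial :: "nat \<Rightarrow> complex \<Rightarrow> complex" where
  "disk_monomial n = of_coeffs (\<lambda>k. if k = n then 1 else 0)"

lemma
  shows disk_monomial_hardy2: "disk_monomial n \<in> hardy2"
    and taylor_coeff_disk_monomial: "taylor_coeff (disk_monomial n) k = (if k = n then 1 else 0)"
proof -
  have "sq_summable (\<lambda>k. if k = n then 1 else 0)"
    unfolding sq_summable_def by (rule summable_finite[of "{n}"]) auto
  then show "disk_monomial n \<in> hardy2" "taylor_coeff (disk_monomial n) k = (if k = n then 1 else 0)"
    unfolding disk_monomial_def by (auto simp: of_coeffs_hardy2 taylor_coeff_of_coeffs)
qed

definition taylor_poly :: "nat \<Rightarrow> (nat \<Rightarrow> complex) \<Rightarrow> complex \<Rightarrow> complex" where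
  "taylor_poly n a = (\<Sum>k<n. cscale (a k) (disk_monomial k))"

lemma taylor_poly_hardy2: "taylor_poly n a \<in> hardy2"
  unfolding taylor_poly_def by (intro hardy2_sum hardy2_scale disk_monomial_hardy2)

lemma taylor_coeff_taylor_poly: "taylor_coeff (taylor_poly n a) k = (if k < n then a k else 0)"
  unfolding taylor_poly_def
  by (subst taylor_coeff_sum)
     (auto simp: hardy2_scale disk_monomial_hardy2 taylor_coeff_scale taylor_coeff_disk_monomial
       if_distrib[of "(*) _"] cong: if_cong)

lemma hnorm_taylor_poly: "(hnorm (taylor_poly n a))\<^sup>2 = (\<Sum>k<n. (cmod (a k))\<^sup>2)"
proof -
  have "(\<Sum>k. (cmod (taylor_coeff (taylor_poly n a) k))\<^sup>2) =
      (\<Sum>k<n. (cmod (taylor_coeff (taylor_poly n a) k))\<^sup>2)"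
    by (rule suminf_finite) (auto simp: taylor_coeff_taylor_poly)
  then show ?thesis
    by (simp add: hnorm_def taylor_coeff_taylor_poly sum_nonneg)
qed

lemma taylor_poly_tendsto:
  assumes "f \<in> hardy2"
  shows "(\<lambda>n. hnorm (f - taylor_poly n (taylor_coeff f))) \<longlonglongrightarrow> 0"
proof -
  let ?c = "\<lambda>k. (cmod (taylor_coeff f k))\<^sup>2"
  have sm: "summable ?c" using assms by (simp add: hardy2_def)
  have "hnorm (f - taylor_poly n (taylor_coeff f)) = sqrt ((\<Sum>k. ?c k) - (\<Sum>k<n. ?c k))" for n
  proof -
    let ?d = "\<lambda>k. (cmod (taylor_coeff (f - taylor_poly n (taylor_coeff f)) k))\<^sup>2"
    have d: "?d k = (if k < n then 0 else ?c k)" for k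
      by (simp add: taylor_coeff_diff[OF assms taylor_poly_hardy2] taylor_coeff_taylor_poly)
    have "summable ?d"
      using hardy2_diff[OF assms taylor_poly_hardy2] by (simp add: hardy2_def)
    then have "suminf ?d = (\<Sum>k. ?d (k + n)) + (\<Sum>k<n. ?d k)"
      by (rule suminf_split_initial_segment)
    also have "\<dots> = (\<Sum>k. ?c (k + n))" by (simp add: d)
    also have "\<dots> = suminf ?c - (\<Sum>k<n. ?c k)"
      by (rule suminf_minus_initial_segment[OF sm])
    finally show ?thesis by (simp add: hnorm_def)
  qed
  moreover have "(\<lambda>n. sqrt ((\<Sum>k. ?c k) - (\<Sum>k<n. ?c k))) \<longlonglongrightarrow> sqrt ((\<Sum>k. ?c k) - (\<Sum>k. ?c k))"
    by (intro tendsto_intros summable_LIMSEQ sm)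
  ultimately show ?thesis by simp
qed

text \<open>The representing function must have the coefficients \<open>cnj (\<phi> (z ^ k))\<close>. Testing
  \<open>\<phi>\<close> on the Taylor polynomials with these very coefficients gives \<open>S \<le> C * sqrt S\<close> for the
  partial sums \<open>S\<close> of their squares, so \<open>S \<le> C\<^sup>2\<close> and the function lies in the Hardy space;
  the formula for all \<open>h\<close> follows by approximation with Taylor polynomials.\<close>

lemma riesz_representation:
  assumes add: "\<And>f g. f \<in> hardy2 \<Longrightarrow> g \<in> hardy2 \<Longrightarrow> \<phi> (f + g) = \<phi> f + \<phi> g"
    and scale: "\<And>c f. f \<in> hardy2 \<Longrightarrow> \<phi> (cscale c f) = c * \<phi> f"
    and bound: "\<And>f. f \<in> hardy2 \<Longrightarrow> cmod (\<phi> f) \<le> C * hnorm f"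
  obtains g where "g \<in> hardy2" "\<And>h. h \<in> hardy2 \<Longrightarrow> \<phi> h = hinner g h"
proof -
  define b where "b k = \<phi> (disk_monomial k)" for k
  have sum: "\<phi> (\<Sum>i\<in>A. f i) = (\<Sum>i\<in>A. \<phi> (f i))"
    if "finite A" "\<And>i. i \<in> A \<Longrightarrow> f i \<in> hardy2" for A and f :: "nat \<Rightarrow> complex \<Rightarrow> complex"
    using that
  proof (induction A)
    case empty
    show "\<phi> (\<Sum>i\<in>{}. f i) = (\<Sum>i\<in>{}. \<phi> (f i))"
      using scale[of 0 0] hardy2_zero by simp
  next
    case (insert a A)
    then show "\<phi> (\<Sum>i\<in>insert a A. f i) = (\<Sum>i\<in>insert a A. \<phi> (f i))"
      by (simp add: add hardy2_sum)
  qed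
  have poly: "\<phi> (taylor_poly n a) = (\<Sum>k<n. a k * b k)" for n a
    unfolding taylor_poly_def b_def
    by (subst sum) (auto simp: scale hardy2_scale disk_monomial_hardy2)
  define g where "g = of_coeffs (\<lambda>k. cnj (b k))"
  have "(\<Sum>k<n. (cmod (b k))\<^sup>2) \<le> C\<^sup>2" for n
  proof -
    \<comment> \<open>the Taylor polynomial on which the bound on \<open>\<phi>\<close> is sharpest\<close>
    let ?p = "taylor_poly n (\<lambda>k. cnj (b k))"
    define S where "S = (\<Sum>k<n. (cmod (b k))\<^sup>2)"
    have S: "(hnorm ?p)\<^sup>2 = S" "S \<ge> 0"
      by (auto simp: hnorm_taylor_poly S_def intro: sum_nonneg)
    have "\<phi> ?p = (\<Sum>k<n. b k * cnj (b k))" by (simp add: poly mult.commute)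
    also have "\<dots> = of_real S"
      unfolding S_def of_real_sum by (intro sum.cong refl complex_norm_square[symmetric])
    finally have "cmod (\<phi> ?p) = S" using S by simp
    then have "S \<le> C * hnorm ?p" using bound[OF taylor_poly_hardy2[of n "\<lambda>k. cnj (b k)"]] by simp
    then have "S\<^sup>2 \<le> (C * hnorm ?p)\<^sup>2" using S(2) by (rule power_mono)
    then have "S * S \<le> C\<^sup>2 * S" unfolding power_mult_distrib S(1) by (simp add: power2_eq_square)
    then show ?thesis unfolding S_def[symmetric]
      using S(2) by (cases "S = 0") (auto simp: mult_le_cancel_right)
  qed
  then have "sq_summable (\<lambda>k. cnj (b k))"
    unfolding sq_summable_def by (intro summableI_nonneg_bounded[of _ "C\<^sup>2"]) auto
  then have g: "g \<in> hardy2" "\<And>k. taylor_coeff g k = cnj (b k)"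
    unfolding g_def by (auto simp: of_coeffs_hardy2 taylor_coeff_of_coeffs)
  moreover have "\<phi> h = hinner g h" if h: "h \<in> hardy2" for h
  proof (rule LIMSEQ_unique)
    let ?t = "\<lambda>n. taylor_poly n (taylor_coeff h)"
    have eq: "\<phi> (?t n) = (\<Sum>k<n. cnj (taylor_coeff g k) * taylor_coeff h k)" for n
      by (simp add: poly g mult.commute)
    show "(\<lambda>n. \<phi> (?t n)) \<longlonglongrightarrow> hinner g h"
      unfolding eq hinner_def by (rule summable_LIMSEQ[OF hinner_summable[OF g(1) h]])
    have "\<phi> h - \<phi> (?t n) = \<phi> (h - ?t n)" for n
      using add[OF hardy2_diff[OF h taylor_poly_hardy2] taylor_poly_hardy2, of n "taylor_coeff h" n "taylor_coeff h"]
      by simp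
    then have "cmod (\<phi> h - \<phi> (?t n)) \<le> C * hnorm (h - ?t n)" for n
      using bound[OF hardy2_diff[OF h taylor_poly_hardy2]] by simp
    moreover have "(\<lambda>n. C * hnorm (h - ?t n)) \<longlonglongrightarrow> 0"
      using tendsto_mult[OF tendsto_const taylor_poly_tendsto[OF h], of C] by simp
    ultimately have "(\<lambda>n. \<phi> h - \<phi> (?t n)) \<longlonglongrightarrow> 0"
      by (rule Lim_null_comparison[OF always_eventually[OF allI]])
    then show "(\<lambda>n. \<phi> (?t n)) \<longlonglongrightarrow> \<phi> h"
      using tendsto_diff[OF tendsto_const[of "\<phi> h"], of "\<lambda>n. \<phi> h - \<phi> (?t n)" 0 sequentially] by simp
  qed
  ultimately show thesis using that by blast
qed

lemma bounded_op_hardy2: "bounded_op U \<Longrightarrow> f \<in> hardy2 \<Longrightarrow> U f \<in> hardy2"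
  by (auto simp: bounded_op_def PiE_iff)

lemma bounded_op_add: "bounded_op U \<Longrightarrow> f \<in> hardy2 \<Longrightarrow> g \<in> hardy2 \<Longrightarrow> U (f + g) = U f + U g"
  by (simp add: bounded_op_def plus_fun_def)

lemma bounded_op_scale: "bounded_op U \<Longrightarrow> f \<in> hardy2 \<Longrightarrow> U (cscale c f) = cscale c (U f)"
  by (simp add: bounded_op_def cscale_def)

text \<open>The operator \<open>adj_op\<close> is given by a definite description, so that a computation with it
  needs both a candidate for the adjoint value and the density of \<open>D\<close>, here in the form that
  nothing but \<open>0\<close> is orthogonal to \<open>D\<close>.\<close>

lemma adj_op_eqI:
  assumes "g \<in> hardy2" "\<And>h. h \<in> D \<Longrightarrow> hinner f (T h) = hinner g h"
    and D: "D \<subseteq> hardy2"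
    and dense: "\<And>k. k \<in> hardy2 \<Longrightarrow> (\<And>h. h \<in> D \<Longrightarrow> hinner k h = 0) \<Longrightarrow> k = 0"
  shows "adj_op D T f = g"
  unfolding adj_op_def
proof (rule the_equality)
  fix g' assume g': "g' \<in> hardy2 \<and> (\<forall>h\<in>D. hinner f (T h) = hinner g' h)"
  have "hinner (g' - g) h = 0" if "h \<in> D" for h
    using that g' assms(1) assms(2)[of h] D by (subst hinner_diff_left) auto
  then have "g' - g = 0"
    using g' assms(1) by (intro dense hardy2_diff) auto
  then show "g' = g" by simp
qed (use assms in auto)

lemma hardy2_dense: "k \<in> hardy2 \<Longrightarrow> (\<And>h. h \<in> hardy2 \<Longrightarrow> hinner k h = 0) \<Longrightarrow> k = 0"
  using hinner_self_eq_0 by blast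

lemma hinner_adj_op_bounded:
  assumes U: "bounded_op U" and f: "f \<in> hardy2" and h: "h \<in> hardy2"
  shows "hinner (adj_op hardy2 U f) h = hinner f (U h)"
proof -
  obtain C where C: "\<And>h. h \<in> hardy2 \<Longrightarrow> hnorm (U h) \<le> C * hnorm h"
    using U unfolding bounded_op_def by blast
  have bd: "cmod (hinner f (U h)) \<le> (hnorm f * C) * hnorm h" if "h \<in> hardy2" for h
  proof -
    have "cmod (hinner f (U h)) \<le> hnorm f * hnorm (U h)"
      by (rule hinner_Cauchy_Schwarz[OF f bounded_op_hardy2[OF U that]])
    also have "\<dots> \<le> hnorm f * (C * hnorm h)"
      by (rule mult_left_mono[OF C[OF that] hnorm_nonneg[OF f]])
    finally show ?thesis by (simp add: mult.assoc)
  qed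
  obtain g where g: "g \<in> hardy2" "\<And>h. h \<in> hardy2 \<Longrightarrow> hinner f (U h) = hinner g h"
    by (rule riesz_representation[of "\<lambda>h. hinner f (U h)" "hnorm f * C"])
       (auto simp: bounded_op_add[OF U] bounded_op_scale[OF U] hinner_add_right
         hinner_scale_right bounded_op_hardy2[OF U] f bd)
  have "adj_op hardy2 U f = g"
    by (rule adj_op_eqI[OF g subset_refl hardy2_dense])
  then show ?thesis using g(2)[OF h] by simp
qed

section \<open>Boundary values and the deficiency vectors\<close>

text \<open>Subtracting \<open>x a\<close> times the sequence from its shift removes the frequency \<open>x a\<close> and
  multiplies every other coefficient by the nonzero number \<open>x i - x a\<close>; so by induction only
  the frequency \<open>x a\<close> remains, whose terms have constant modulus \<open>cmod (c a)\<close>.\<close>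

lemma exponential_sum_tendsto_0:
  fixes c x :: "'a \<Rightarrow> complex"
  assumes "finite F" "inj_on x F" "\<And>i. i \<in> F \<Longrightarrow> cmod (x i) = 1"
    and "(\<lambda>k. \<Sum>i\<in>F. c i * x i ^ k) \<longlonglongrightarrow> 0" "j \<in> F"
  shows "c j = 0"
  using assms
proof (induction F arbitrary: c j)
  case empty
  then show ?case by simp
next
  case (insert a F)
  let ?s = "\<lambda>k. \<Sum>i\<in>insert a F. c i * x i ^ k"
  have ne: "x i \<noteq> x a" if "i \<in> F" for i
    using insert.prems(1) insert.hyps that by (auto simp: inj_on_def)
  have "(\<lambda>k. ?s (Suc k) - x a * ?s k) \<longlonglongrightarrow> 0 - x a * 0"
    by (intro tendsto_diff tendsto_mult tendsto_const LIMSEQ_Suc insert.prems(3))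
  moreover have "?s (Suc k) - x a * ?s k = (\<Sum>i\<in>F. (c i * (x i - x a)) * x i ^ k)" for k
    using insert.hyps
    by (simp add: sum_distrib_left sum_subtractf[symmetric] algebra_simps)
  ultimately have lim: "(\<lambda>k. \<Sum>i\<in>F. (c i * (x i - x a)) * x i ^ k) \<longlonglongrightarrow> 0"
    by simp
  have F: "c i = 0" if "i \<in> F" for i
    using insert.IH[OF _ _ lim that] insert.prems that ne[OF that] by auto
  have "?s k = c a * x a ^ k" for k
    using F insert.hyps by simp
  then have "(\<lambda>k. cmod (c a * x a ^ k)) \<longlonglongrightarrow> 0"
    using tendsto_norm_zero[OF insert.prems(3)] by (simp only:)
  then have "(\<lambda>k. cmod (c a)) \<longlonglongrightarrow> 0"
    using insert.prems(2)[of a] by (simp add: norm_mult norm_power)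
  then have "c a = 0" by (simp add: LIMSEQ_const_iff)
  then show "c j = 0" using F insert.prems(4) by auto
qed

text \<open>Write the coefficient as the product of the two square-summable sequences
  \<open>1 / (k + 1)\<close> and \<open>(k + 1) * taylor_coeff f k\<close>.\<close>

lemma summable_taylor_coeff:
  assumes "f \<in> dom_H"
  shows "summable (\<lambda>k. cmod (taylor_coeff f k))"
proof -
  have f: "f \<in> hardy2" "euler_op f \<in> hardy2" using assms by (auto simp: dom_H_def)
  have "sq_summable (\<lambda>k. of_nat k * taylor_coeff f k + taylor_coeff f k)"
    using f euler_op_hardy2_iff[OF f(1)] by (intro sq_summable_add) (auto simp: hardy2_iff)
  moreover note sq_summable_inverse_Suc
  ultimately have "summable (\<lambda>k. cmod (complex_of_real (inverse (real (Suc k)))) *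
      cmod (of_nat k * taylor_coeff f k + taylor_coeff f k))"
    using sq_summable_mult by blast
  moreover have "cmod (complex_of_real (inverse (real (Suc k)))) *
      cmod (of_nat k * taylor_coeff f k + taylor_coeff f k) = cmod (taylor_coeff f k)" for k
  proof -
    have "of_nat k * taylor_coeff f k + taylor_coeff f k = of_nat (Suc k) * taylor_coeff f k"
      by (simp add: algebra_simps)
    then have "cmod (of_nat k * taylor_coeff f k + taylor_coeff f k)
        = real (Suc k) * cmod (taylor_coeff f k)"
      by (simp only: norm_mult norm_of_nat)
    then show ?thesis by (simp only: norm_of_real) (simp add: field_simps)
  qed
  ultimately show ?thesis by simp
qed

text \<open>The power series converges uniformly on the closed disk by the Weierstrass test, so its sum
  is continuous there and agrees with \<open>f\<close> inside.\<close>

lemma cont_ext_eq_suminf: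
  assumes f: "f \<in> dom_H" and \<zeta>: "cmod \<zeta> = 1"
  shows "cont_ext f \<zeta> = (\<Sum>k. taylor_coeff f k * \<zeta> ^ k)"
proof -
  let ?g = "\<lambda>z. \<Sum>k. taylor_coeff f k * z ^ k"
  have "uniform_limit (cball 0 1) (\<lambda>n z. \<Sum>k<n. taylor_coeff f k * z ^ k) ?g sequentially"
  proof (rule Weierstrass_m_test[OF _ summable_taylor_coeff[OF f]])
    fix n and z :: complex assume "z \<in> cball 0 1"
    then have "cmod z ^ n \<le> 1" by (intro power_le_one) auto
    then show "cmod (taylor_coeff f n * z ^ n) \<le> cmod (taylor_coeff f n)"
      by (simp add: norm_mult norm_power mult_left_le)
  qed
  then have "continuous_on (cball 0 1) ?g"
    by (rule uniform_limit_theorem[rotated]) (auto intro!: always_eventually continuous_intros)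
  then have "(?g \<longlongrightarrow> ?g \<zeta>) (at \<zeta> within cball 0 1)"
    using \<zeta> by (simp add: continuous_on_def)
  then have "(?g \<longlongrightarrow> ?g \<zeta>) (at \<zeta> within ball 0 1)"
    by (rule tendsto_within_subset) auto
  moreover have "\<forall>\<^sub>F z in at \<zeta> within ball 0 1. ?g z = f z"
    using hardy2_sums[of f] f
    by (auto simp: eventually_at_filter dom_H_def sums_iff intro!: always_eventually)
  ultimately have "(f \<longlongrightarrow> ?g \<zeta>) (at \<zeta> within ball 0 1)"
    by (rule Lim_transform_eventually)
  moreover have "\<zeta> islimpt ball 0 1"
    using \<zeta> by (simp add: islimpt_ball)
  then have "at \<zeta> within ball 0 1 \<noteq> bot"
    by (simp add: trivial_limit_within)
  ultimately show ?thesis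
    unfolding cont_ext_def by (intro tendsto_Lim)
qed

text \<open>This is the inverse of \<open>H - l\<close>, for \<open>H\<close> the Euler operator on its full domain. The
  spectrum of \<open>H\<close> is \<open>\<nat>\<close>, which explains the hypothesis \<open>l \<notin> \<nat>\<close> in what follows.\<close>

definition resolvent :: "complex \<Rightarrow> (complex \<Rightarrow> complex) \<Rightarrow> complex \<Rightarrow> complex" where
  "resolvent l u = of_coeffs (\<lambda>k. taylor_coeff u k / (of_nat k - l))"

lemma of_nat_minus_nonzero: "l \<notin> \<nat> \<Longrightarrow> of_nat k - l \<noteq> (0::complex)"
  by (metis eq_iff_diff_eq_0 of_nat_in_Nats)

lemma imaginary_unit_notin_Nats: "\<i> \<notin> \<nat>" "- \<i> \<notin> \<nat>"
  by (auto elim!: Nats_cases simp: complex_eq_iff)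

lemma cnj_notin_Nats: "l \<notin> \<nat> \<Longrightarrow> cnj l \<notin> \<nat>"
  by (metis Nats_cases complex_cnj_cnj complex_cnj_of_nat of_nat_in_Nats)

lemma
  assumes l: "l \<notin> \<nat>" and u: "u \<in> hardy2"
  shows resolvent_dom_H: "resolvent l u \<in> dom_H"
    and resolvent_hardy2: "resolvent l u \<in> hardy2"
    and taylor_coeff_resolvent:
      "taylor_coeff (resolvent l u) k = taylor_coeff u k / (of_nat k - l)"
proof -
  obtain C where C: "C > 0" "\<And>k. real k + 1 \<le> C * cmod (of_nat k - l)"
    using norm_shift_ge[OF l] by blast
  have tu: "sq_summable (taylor_coeff u)" using u by (simp add: hardy2_iff)
  have pos: "cmod (of_nat k - l) > 0" for k
    using of_nat_minus_nonzero[OF l] by simp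
  have "sq_summable (\<lambda>k. taylor_coeff u k / (of_nat k - l))"
  proof (rule sq_summable_bound[OF tu])
    fix k
    have "1 \<le> C * cmod (of_nat k - l)" using C(2)[of k] by simp
    then have "cmod (taylor_coeff u k) * 1 \<le> cmod (taylor_coeff u k) * (C * cmod (of_nat k - l))"
      by (intro mult_left_mono) auto
    then show "cmod (taylor_coeff u k / (of_nat k - l)) \<le> C * cmod (taylor_coeff u k)"
      using pos[of k] by (simp add: norm_divide field_simps)
  qed
  then show r: "resolvent l u \<in> hardy2"
    and tr: "taylor_coeff (resolvent l u) k = taylor_coeff u k / (of_nat k - l)" for k
    unfolding resolvent_def by (rule of_coeffs_hardy2, rule taylor_coeff_of_coeffs)
  have "sq_summable (\<lambda>k. of_nat k * taylor_coeff (resolvent l u) k)"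
  proof (rule sq_summable_bound[OF tu])
    fix k
    have "real k \<le> C * cmod (of_nat k - l)" using C(2)[of k] by simp
    then have "cmod (taylor_coeff u k) * real k
        \<le> cmod (taylor_coeff u k) * (C * cmod (of_nat k - l))"
      by (intro mult_left_mono) auto
    then show "cmod (of_nat k * taylor_coeff (resolvent l u) k) \<le> C * cmod (taylor_coeff u k)"
      using pos[of k] by (simp add: tr norm_divide norm_mult field_simps)
  qed
  then show "resolvent l u \<in> dom_H"
    using r euler_op_hardy2_iff[OF r] by (simp add: dom_H_def)
qed

lemma hinner_resolvent:
  assumes "l \<notin> \<nat>" "f \<in> hardy2" "u \<in> hardy2"
  shows "hinner (resolvent l f) u = hinner f (resolvent (cnj l) u)"
  unfolding hinner_def using assms
  by (simp add: taylor_coeff_resolvent cnj_notin_Nats)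

lemma deficiency_vector_eq:
  "deficiency_vector l \<zeta> = of_coeffs (\<lambda>n. cnj \<zeta> ^ n / (of_nat n - l))"
  by (auto simp: deficiency_vector_def of_coeffs_def fun_eq_iff power_mult_distrib)

lemma
  assumes l: "l \<notin> \<nat>" and \<zeta>: "cmod \<zeta> = 1"
  shows deficiency_vector_hardy2: "deficiency_vector l \<zeta> \<in> hardy2"
    and taylor_coeff_deficiency_vector:
      "taylor_coeff (deficiency_vector l \<zeta>) k = cnj \<zeta> ^ k / (of_nat k - l)"
proof -
  obtain C where C: "C > 0" "\<And>k. real k + 1 \<le> C * cmod (of_nat k - l)"
    using norm_shift_ge[OF l] by blast
  have "sq_summable (\<lambda>n. cnj \<zeta> ^ n / (of_nat n - l))"
  proof (rule sq_summable_bound[OF sq_summable_inverse_Suc])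
    fix k
    have "cmod (of_nat k - l) > 0"
      using of_nat_minus_nonzero[OF l] by simp
    then show "cmod (cnj \<zeta> ^ k / (of_nat k - l)) \<le> C * cmod (complex_of_real (inverse (real (Suc k))))"
      using C(2)[of k] \<zeta> by (simp only: norm_of_real) (simp add: norm_divide norm_power field_simps)
  qed
  then show "deficiency_vector l \<zeta> \<in> hardy2"
    and "taylor_coeff (deficiency_vector l \<zeta>) k = cnj \<zeta> ^ k / (of_nat k - l)"
    unfolding deficiency_vector_eq by (rule of_coeffs_hardy2, rule taylor_coeff_of_coeffs)
qed

text \<open>Evaluation at a boundary point, an unbounded functional, becomes after composition with the
  resolvent the bounded functional represented by the deficiency vector. Hence \<open>dom_L F\<close> is the
  image under the resolvent of the orthogonal complement of the deficiency vectors.\<close>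

lemma cont_ext_resolvent:
  assumes l: "l \<notin> \<nat>" and \<zeta>: "cmod \<zeta> = 1" and u: "u \<in> hardy2"
  shows "cont_ext (resolvent (cnj l) u) \<zeta> = hinner (deficiency_vector l \<zeta>) u"
  using assms cnj_notin_Nats[OF l]
  by (simp add: cont_ext_eq_suminf resolvent_dom_H hinner_def taylor_coeff_resolvent
      taylor_coeff_deficiency_vector mult.commute)

lemma span_image_sum:
  assumes "finite F" "x \<in> fs.span (v ` F)"
  shows "\<exists>c. x = (\<Sum>i\<in>F. cscale (c i) (v i))"
  using assms(2)
proof (induction rule: fs.span_induct_alt)
  case base
  show "\<exists>c. 0 = (\<Sum>i\<in>F. cscale (c i) (v i))"
    by (rule exI[of _ "\<lambda>_. 0"]) simp
next
  case (step a y z)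
  then obtain j c where j: "j \<in> F" "y = v j" and z: "z = (\<Sum>i\<in>F. cscale (c i) (v i))"
    by blast
  have "(\<Sum>i\<in>F. cscale ((if i = j then a else 0) + c i) (v i))
      = (\<Sum>i\<in>F. if i = j then cscale a (v i) else 0) + z"
    by (simp add: fs.scale_left_distrib sum.distrib z if_distrib[of "\<lambda>t. cscale t _"] cong: if_cong)
  also have "\<dots> = cscale a y + z"
    using j assms(1) by simp
  finally show "\<exists>c. cscale a y + z = (\<Sum>i\<in>F. cscale (c i) (v i))"
    by metis
qed

lemma sum_in_span_image: "(\<Sum>i\<in>F. cscale (c i) (v i)) \<in> fs.span (v ` F)"
  by (intro fs.span_sum fs.span_scale fs.span_base) auto

lemma taylor_coeff_deficiency_lincomb:
  assumes "F \<subseteq> sphere 0 1" and l: "l \<notin> \<nat>"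
  shows "taylor_coeff (\<Sum>\<zeta>\<in>F. cscale (c \<zeta>) (deficiency_vector l \<zeta>)) k =
           (\<Sum>\<zeta>\<in>F. c \<zeta> * cnj \<zeta> ^ k) / (of_nat k - l)"
proof -
  have H: "deficiency_vector l \<zeta> \<in> hardy2" if "\<zeta> \<in> F" for \<zeta>
    using that assms(1) by (intro deficiency_vector_hardy2 l) auto
  have "taylor_coeff (\<Sum>\<zeta>\<in>F. cscale (c \<zeta>) (deficiency_vector l \<zeta>)) k =
      (\<Sum>\<zeta>\<in>F. c \<zeta> * (cnj \<zeta> ^ k / (of_nat k - l)))"
    using assms(1) by (subst taylor_coeff_sum)
      (auto intro!: sum.cong hardy2_scale H
        simp: taylor_coeff_scale[OF H] taylor_coeff_deficiency_vector[OF l] subset_iff)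
  then show ?thesis by (simp add: sum_divide_distrib)
qed

lemma deficiency_vector_lincomb_0:
  assumes F: "finite F" "F \<subseteq> sphere 0 1" and l: "l \<notin> \<nat>"
    and eq: "(\<Sum>\<zeta>\<in>F. cscale (c \<zeta>) (deficiency_vector l \<zeta>)) = 0" and "\<zeta> \<in> F"
  shows "c \<zeta> = 0"
proof -
  have "(\<Sum>\<zeta>\<in>F. c \<zeta> * cnj \<zeta> ^ k) = 0" for k
    using taylor_coeff_deficiency_lincomb[OF F(2) l, of c k] of_nat_minus_nonzero[OF l, of k]
    by (simp add: eq)
  then show ?thesis
    using F \<open>\<zeta> \<in> F\<close>
    by (intro exponential_sum_tendsto_0[of F cnj c]) (auto simp: inj_on_def)
qed

section \<open>Density of the domain and the deficiency spaces\<close>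

lemma dom_L_subset_hardy2: "dom_L F \<subseteq> hardy2"
  by (auto simp: dom_L_def dom_H_def)

lemma resolvent_in_dom_L:
  assumes "F \<subseteq> sphere 0 1" "l \<notin> \<nat>" "u \<in> hardy2"
    and "\<And>\<zeta>. \<zeta> \<in> F \<Longrightarrow> hinner (deficiency_vector l \<zeta>) u = 0"
  shows "resolvent (cnj l) u \<in> dom_L F"
  using assms
  by (auto simp: dom_L_def resolvent_dom_H cnj_notin_Nats cont_ext_resolvent subset_iff)

text \<open>If \<open>g\<close> is orthogonal to \<open>dom_L F\<close>, then the resolvent of \<open>g\<close> is orthogonal to
  everything orthogonal to the deficiency vectors, so it is a combination of them. Multiplying
  coefficients by \<open>k - \<i>\<close> shows that the coefficients of \<open>g\<close> are an exponential sum with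
  frequencies on the unit circle. They tend to \<open>0\<close>, so the sum is trivial.\<close>

lemma dom_L_dense:
  assumes F: "finite F" "F \<subseteq> sphere 0 1"
    and g: "g \<in> hardy2" and perp: "\<And>h. h \<in> dom_L F \<Longrightarrow> hinner g h = 0"
  shows "g = 0"
proof -
  note l = imaginary_unit_notin_Nats(1)
  let ?v = "deficiency_vector \<i>"
  have H: "?v \<zeta> \<in> hardy2" if "\<zeta> \<in> F" for \<zeta>
    using that F by (intro deficiency_vector_hardy2 l) auto
  have "resolvent \<i> g \<in> fs.span (?v ` F)"
  proof (rule double_orthogonal_complement_subset_span)
    fix u assume "u \<in> hardy2" "\<And>b. b \<in> ?v ` F \<Longrightarrow> hinner b u = 0"
    then show "hinner (resolvent \<i> g) u = 0"
      using perp[OF resolvent_in_dom_L[OF F(2) l, of u]] hinner_resolvent[OF l g, of u] by auto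
  qed (use F H resolvent_hardy2[OF l g] in auto)
  then obtain c where c: "resolvent \<i> g = (\<Sum>\<zeta>\<in>F. cscale (c \<zeta>) (?v \<zeta>))"
    using span_image_sum[OF F(1)] by blast
  have coeff: "taylor_coeff g k = (\<Sum>\<zeta>\<in>F. c \<zeta> * cnj \<zeta> ^ k)" for k
    using taylor_coeff_resolvent[OF l g, of k] of_nat_minus_nonzero[OF l, of k]
      taylor_coeff_deficiency_lincomb[OF F(2) l, of c k] by (simp add: c)
  have "taylor_coeff g \<longlonglongrightarrow> 0"
    using g by (intro sq_summable_tendsto_0) (simp add: hardy2_iff)
  then have "(\<lambda>k. \<Sum>\<zeta>\<in>F. c \<zeta> * cnj \<zeta> ^ k) \<longlonglongrightarrow> 0"
    unfolding coeff[abs_def] .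
  then have "c \<zeta> = 0" if "\<zeta> \<in> F" for \<zeta>
    using F that by (intro exponential_sum_tendsto_0[of F cnj c]) (auto simp: inj_on_def)
  then have "taylor_coeff g k = 0" for k by (simp add: coeff)
  then show "g = 0" by (intro hardy2_eqI g hardy2_zero) simp
qed

text \<open>Density of the domain makes the adjoint single-valued, which turns the eigenvalue equation
  into a weak identity free of definite descriptions.\<close>

lemma deficiency_space_iff:
  assumes F: "finite F" "F \<subseteq> sphere 0 1"
  shows "f \<in> adj_dom (dom_L F) euler_op \<and> adj_op (dom_L F) euler_op f = (\<lambda>z. l * f z) \<longleftrightarrow>
           f \<in> hardy2 \<and> (\<forall>h\<in>dom_L F. hinner f (euler_op h) = hinner (cscale l f) h)"
    (is "?L \<longleftrightarrow> ?R")
proof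
  have adj: "adj_op (dom_L F) euler_op f = g"
    if "g \<in> hardy2" "\<forall>h\<in>dom_L F. hinner f (euler_op h) = hinner g h" for g
    using that dom_L_dense[OF F] by (intro adj_op_eqI dom_L_subset_hardy2) blast+
  show ?R if L: ?L
  proof -
    obtain g where g: "g \<in> hardy2" "\<forall>h\<in>dom_L F. hinner f (euler_op h) = hinner g h"
      using L unfolding adj_dom_def by blast
    then have "g = cscale l f" using adj[OF g] L by (simp add: cscale_def)
    then show ?R using g L by (simp add: adj_dom_def)
  qed
  show ?L if R: ?R
    using R adj[of "cscale l f"] hardy2_scale[of f l]
    unfolding adj_dom_def cscale_def by blast
qed

text \<open>Weakly, the eigenvalue equation says that \<open>f\<close> is orthogonal to the range of
  \<open>L - cnj l\<close> on \<open>dom_L F\<close>, for \<open>L\<close> the restricted Euler operator. Through the resolvent,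
  this range is exactly the orthogonal complement of the finitely many deficiency vectors.\<close>

lemma deficiency_space_eq_span:
  assumes F: "finite F" "F \<subseteq> sphere 0 1" and l: "l \<notin> \<nat>"
  shows "{f \<in> adj_dom (dom_L F) euler_op. adj_op (dom_L F) euler_op f = (\<lambda>z. l * f z)} =
           fs.span (deficiency_vector l ` F)"
    (is "?D = fs.span (?v ` F)")
proof -
  have V: "?v ` F \<subseteq> hardy2"
    using F by (auto intro!: deficiency_vector_hardy2 l)
  have dom: "h \<in> hardy2" "euler_op h \<in> hardy2" if "h \<in> dom_L F" for h
    using that by (auto simp: dom_L_def dom_H_def)
  have D: "f \<in> ?D \<longleftrightarrow> f \<in> hardy2 \<and> (\<forall>h\<in>dom_L F. hinner f (euler_op h - cscale (cnj l) h) = 0)" for f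
    using deficiency_space_iff[OF F, of f l] dom
    by (auto simp: hinner_diff_right hinner_scale_right hinner_scale_left hardy2_scale)
  show ?thesis
  proof (intro equalityI subsetI)
    fix f assume "f \<in> ?D"
    then have f: "f \<in> hardy2"
      and perp: "\<And>h. h \<in> dom_L F \<Longrightarrow> hinner f (euler_op h - cscale (cnj l) h) = 0"
      using D by auto
    show "f \<in> fs.span (?v ` F)"
    proof (rule double_orthogonal_complement_subset_span[OF _ V f])
      fix u assume u: "u \<in> hardy2" "\<And>b. b \<in> ?v ` F \<Longrightarrow> hinner b u = 0"
      let ?h = "resolvent (cnj l) u"
      have h: "?h \<in> dom_L F"
        using u by (intro resolvent_in_dom_L F l) auto
      have "euler_op ?h - cscale (cnj l) ?h = u"
      proof (rule hardy2_eqI)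
        fix k
        show "taylor_coeff (euler_op ?h - cscale (cnj l) ?h) k = taylor_coeff u k"
          using dom[OF h] of_nat_minus_nonzero[OF cnj_notin_Nats[OF l], of k]
          by (simp add: taylor_coeff_diff hardy2_scale taylor_coeff_scale taylor_coeff_euler_op
              taylor_coeff_resolvent[OF cnj_notin_Nats[OF l] u(1)]
              diff_divide_distrib[symmetric] left_diff_distrib[symmetric])
      qed (use dom[OF h] u hardy2_diff hardy2_scale in auto)
      then show "hinner f u = 0" using perp[OF h] by simp
    qed (use F in auto)
  next
    fix f assume f: "f \<in> fs.span (?v ` F)"
    then have fH: "f \<in> hardy2" using span_subset_hardy2[OF V] by auto
    moreover have "hinner f (euler_op h - cscale (cnj l) h) = 0" if h: "h \<in> dom_L F" for h
    proof -
      let ?u = "euler_op h - cscale (cnj l) h"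
      have u: "?u \<in> hardy2"
        by (rule hardy2_diff[OF dom(2)[OF h] hardy2_scale[OF dom(1)[OF h]]])
      have "resolvent (cnj l) ?u = h"
      proof (rule hardy2_eqI)
        fix k
        show "taylor_coeff (resolvent (cnj l) ?u) k = taylor_coeff h k"
          using dom[OF h] of_nat_minus_nonzero[OF cnj_notin_Nats[OF l], of k]
          by (simp add: taylor_coeff_diff hardy2_scale taylor_coeff_scale taylor_coeff_euler_op
              taylor_coeff_resolvent[OF cnj_notin_Nats[OF l] u] left_diff_distrib[symmetric])
      qed (use dom[OF h] u resolvent_hardy2 cnj_notin_Nats l in auto)
      then have "hinner (?v \<zeta>) ?u = 0" if "\<zeta> \<in> F" for \<zeta>
        using cont_ext_resolvent[OF l _ u, of \<zeta>] that F h by (auto simp: dom_L_def)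
      moreover obtain c where "f = (\<Sum>\<zeta>\<in>F. cscale (c \<zeta>) (?v \<zeta>))"
        using span_image_sum[OF F(1) f] by blast
      ultimately show ?thesis
        using V u by (auto simp: hinner_sum_left hinner_scale_left hardy2_scale image_subset_iff)
    qed
    ultimately show "f \<in> ?D" unfolding D by blast
  qed
qed

lemma e_angle: "cmod \<zeta> = 1 \<Longrightarrow> e (angle \<zeta>) = \<zeta>"
  using Arg2pi_eq[of \<zeta>] by (simp add: e_def angle_def)

lemma e_angle_diff:
  assumes "cmod \<alpha> = 1" "cmod \<beta> = 1"
  shows "e (real n * (angle \<alpha> - angle \<beta>)) = (\<alpha> * cnj \<beta>) ^ n"
proof -
  have "e (real n * x) = e x ^ n" for x
    unfolding e_def exp_of_nat_mult[symmetric] by (simp add: algebra_simps)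
  moreover have "e (x - y) = e x * cnj (e y)" for x y
    unfolding e_def exp_cnj by (simp add: exp_add[symmetric] algebra_simps)
  ultimately show ?thesis using assms by (simp add: e_angle)
qed

text \<open>Both deficiency bases have the same Gram matrix, because
  \<open>cmod (n - \<i>) = cmod (n + \<i>)\<close>; this is why one matrix \<open>Z (\<alpha> - \<beta>)\<close> occurs on both
  sides of the matrix equation.\<close>

lemma hinner_deficiency_vector:
  assumes l: "l = \<i> \<or> l = - \<i>" and "cmod \<alpha> = 1" "cmod \<beta> = 1"
  shows "hinner (deficiency_vector l \<alpha>) (deficiency_vector l \<beta>) = Z (angle \<alpha> - angle \<beta>)"
proof -
  have N: "l \<notin> \<nat>" using l imaginary_unit_notin_Nats by auto
  have "cnj (of_nat n - l) * (of_nat n - l) = of_real (1 + (real n)\<^sup>2)" for n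
    using l by (auto simp: complex_eq_iff power2_eq_square)
  then have "cnj (cnj \<alpha> ^ n / (of_nat n - l)) * (cnj \<beta> ^ n / (of_nat n - l)) =
      e (real n * (angle \<alpha> - angle \<beta>)) / of_real (1 + (real n)\<^sup>2)" for n
    using assms by (simp add: e_angle_diff power_mult_distrib)
  then show ?thesis
    unfolding hinner_def Z_def using assms N by (simp add: taylor_coeff_deficiency_vector)
qed

section \<open>Partial isometries and matrices\<close>

lemma deficiency_vectors_subset_hardy2:
  assumes "F \<subseteq> sphere 0 1" "l \<notin> \<nat>"
  shows "deficiency_vector l ` F \<subseteq> hardy2"
  using assms by (auto intro!: deficiency_vector_hardy2)

lemma deficiency_plus_eq:
  assumes "finite F" "F \<subseteq> sphere 0 1"
  shows "deficiency_plus F = fs.span (deficiency_vector \<i> ` F)"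
  unfolding deficiency_plus_def
  by (rule deficiency_space_eq_span[OF assms imaginary_unit_notin_Nats(1)])

lemma deficiency_minus_eq:
  assumes "finite F" "F \<subseteq> sphere 0 1"
  shows "deficiency_minus F = fs.span (deficiency_vector (- \<i>) ` F)"
  unfolding deficiency_minus_def
  by (rule deficiency_space_eq_span[OF assms imaginary_unit_notin_Nats(2)])

lemma deficiency_vector_lincomb_eqD:
  assumes F: "finite F" "F \<subseteq> sphere 0 1" and l: "l \<notin> \<nat>"
    and eq: "(\<Sum>\<zeta>\<in>F. cscale (c \<zeta>) (deficiency_vector l \<zeta>)) =
             (\<Sum>\<zeta>\<in>F. cscale (d \<zeta>) (deficiency_vector l \<zeta>))" and "\<zeta> \<in> F"
  shows "c \<zeta> = d \<zeta>"
proof -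
  have "(\<Sum>\<zeta>\<in>F. cscale (c \<zeta> - d \<zeta>) (deficiency_vector l \<zeta>)) = 0"
    using eq by (simp add: fs.scale_left_diff_distrib sum_subtractf)
  then have "c \<zeta> - d \<zeta> = 0"
    by (rule deficiency_vector_lincomb_0[OF F l _ \<open>\<zeta> \<in> F\<close>])
  then show ?thesis by simp
qed

lemma inj_on_deficiency_vector:
  assumes "F \<subseteq> sphere 0 1" and l: "l \<notin> \<nat>"
  shows "inj_on (deficiency_vector l) F"
proof (rule inj_onI)
  fix \<alpha> \<beta> assume "\<alpha> \<in> F" "\<beta> \<in> F" and eq: "deficiency_vector l \<alpha> = deficiency_vector l \<beta>"
  then have n: "cmod \<alpha> = 1" "cmod \<beta> = 1" using assms by auto
  have "taylor_coeff (deficiency_vector l \<alpha>) 1 = taylor_coeff (deficiency_vector l \<beta>) 1"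
    by (simp add: eq)
  then show "\<alpha> = \<beta>"
    using of_nat_minus_nonzero[OF l, of 1]
    by (simp add: taylor_coeff_deficiency_vector[OF l] n)
qed

lemma independent_deficiency_vectors:
  assumes F: "finite F" "F \<subseteq> sphere 0 1" and l: "l \<notin> \<nat>"
  shows "fs.independent (deficiency_vector l ` F)"
proof -
  let ?v = "deficiency_vector l"
  have "u (?v \<zeta>) = 0" if "(\<Sum>x\<in>?v ` F. cscale (u x) x) = 0" "\<zeta> \<in> F" for u \<zeta>
    using deficiency_vector_lincomb_0[OF F l _ that(2), of "\<lambda>\<zeta>. u (?v \<zeta>)"] that(1)
    by (simp add: sum.reindex[OF inj_on_deficiency_vector[OF F(2) l]])
  then show ?thesis
    using fs.dependent_finite[of "?v ` F"] F(1) by blast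
qed

text \<open>Dimension count: the image of \<open>V\<close> is independent, so a vector of the span of \<open>W\<close>
  outside the image would give more than \<open>card W\<close> independent vectors in that span. This
  is what gives surjectivity to an isometry between the deficiency spaces.\<close>

lemma linear_image_span_onto:
  assumes J: "Vector_Spaces.linear cscale cscale J" and inj: "inj_on J (fs.span V)"
    and V: "fs.independent V" "finite V" and W: "finite W" "card W \<le> card V"
    and sub: "J ` V \<subseteq> fs.span W"
  shows "J ` fs.span V = fs.span W"
proof -
  interpret J: Vector_Spaces.linear cscale cscale J by (rule J)
  have ind: "fs.independent (J ` V)"
    by (rule J.independent_injective_image[OF V(1) inj])
  have card: "card (J ` V) = card V"
    using inj fs.span_superset[of V] by (intro card_image) (rule inj_on_subset)
  have "y \<in> fs.span (J ` V)" if y: "y \<in> fs.span W" for y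
  proof (rule ccontr)
    assume ny: "y \<notin> fs.span (J ` V)"
    then have "fs.independent (insert y (J ` V))"
      by (intro fs.independent_insertI ind)
    then have "card (insert y (J ` V)) \<le> card W"
      using fs.independent_span_bound[OF W(1), of "insert y (J ` V)"] y sub by auto
    moreover have "y \<notin> J ` V" using ny fs.span_base by blast
    ultimately show False using V(2) W(2) card by simp
  qed
  moreover have "fs.span (J ` V) \<subseteq> fs.span W"
    by (rule fs.span_minimal[OF sub fs.subspace_span])
  ultimately have "fs.span (J ` V) = fs.span W" by blast
  then show ?thesis by (simp add: J.span_image)
qed

lemma bounded_op_sum:
  assumes U: "bounded_op U" and "finite A" and x: "\<And>i. i \<in> A \<Longrightarrow> x i \<in> hardy2"
  shows "U (\<Sum>i\<in>A. cscale (c i) (x i)) = (\<Sum>i\<in>A. cscale (c i) (U (x i)))"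
  using assms(2,3)
proof (induction A)
  case empty
  show "U (\<Sum>i\<in>{}. cscale (c i) (x i)) = (\<Sum>i\<in>{}. cscale (c i) (U (x i)))"
    using bounded_op_scale[OF U hardy2_zero, of 0] by simp
next
  case (insert a A)
  have "U (cscale (c a) (x a) + (\<Sum>i\<in>A. cscale (c i) (x i)))
      = U (cscale (c a) (x a)) + U (\<Sum>i\<in>A. cscale (c i) (x i))"
    using insert.prems by (intro bounded_op_add[OF U] hardy2_sum hardy2_scale) auto
  then show "U (\<Sum>i\<in>insert a A. cscale (c i) (x i)) = (\<Sum>i\<in>insert a A. cscale (c i) (U (x i)))"
    using insert by (simp add: bounded_op_scale[OF U] del: cscale_apply)
qed

definition represents ::
  "complex set \<Rightarrow> ((complex \<Rightarrow> complex) \<Rightarrow> complex \<Rightarrow> complex) \<Rightarrow> (complex \<times> complex \<Rightarrow> complex) \<Rightarrow> bool"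
  where
  "represents F U M \<longleftrightarrow> (\<forall>\<beta>\<in>F. U (deficiency_vector \<i> \<beta>) =
      (\<Sum>\<alpha>\<in>F. cscale (M (\<alpha>, \<beta>)) (deficiency_vector (- \<i>) \<alpha>)))"

context
  fixes F :: "complex set"
  assumes F: "finite F" "F \<subseteq> sphere 0 1"
begin

lemma norm_F: "\<zeta> \<in> F \<Longrightarrow> cmod \<zeta> = 1"
  using F(2) by auto

lemma plus_subset_hardy2: "deficiency_vector \<i> ` F \<subseteq> hardy2"
  by (rule deficiency_vectors_subset_hardy2[OF F(2) imaginary_unit_notin_Nats(1)])

lemma minus_subset_hardy2: "deficiency_vector (- \<i>) ` F \<subseteq> hardy2"
  by (rule deficiency_vectors_subset_hardy2[OF F(2) imaginary_unit_notin_Nats(2)])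

lemma plus_hardy2: "\<zeta> \<in> F \<Longrightarrow> deficiency_vector \<i> \<zeta> \<in> hardy2"
  using plus_subset_hardy2 by blast

lemma minus_hardy2: "\<zeta> \<in> F \<Longrightarrow> deficiency_vector (- \<i>) \<zeta> \<in> hardy2"
  using minus_subset_hardy2 by blast

lemma hinner_matrix_image:
  assumes "\<alpha> \<in> F" "\<beta> \<in> F"
  shows "hinner (\<Sum>\<gamma>\<in>F. cscale (M (\<gamma>, \<alpha>)) (deficiency_vector (- \<i>) \<gamma>))
                (\<Sum>\<xi>\<in>F. cscale (M (\<xi>, \<beta>)) (deficiency_vector (- \<i>) \<xi>)) =
         (\<Sum>\<gamma>\<in>F. \<Sum>\<xi>\<in>F. cnj (M (\<gamma>, \<alpha>)) * Z (angle \<gamma> - angle \<xi>) * M (\<xi>, \<beta>))"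
  by (simp add: hinner_lincomb minus_hardy2 hinner_deficiency_vector norm_F)

lemma represents_unique_matrix:
  assumes "M \<in> F \<times> F \<rightarrow>\<^sub>E UNIV" "N \<in> F \<times> F \<rightarrow>\<^sub>E UNIV" "represents F U M" "represents F U N"
  shows "M = N"
proof (rule PiE_ext[OF assms(1,2)])
  fix x assume "x \<in> F \<times> F"
  then obtain \<alpha> \<beta> where x: "x = (\<alpha>, \<beta>)" "\<alpha> \<in> F" "\<beta> \<in> F" by auto
  have "(\<Sum>\<alpha>\<in>F. cscale (M (\<alpha>, \<beta>)) (deficiency_vector (- \<i>) \<alpha>)) =
        (\<Sum>\<alpha>\<in>F. cscale (N (\<alpha>, \<beta>)) (deficiency_vector (- \<i>) \<alpha>))"
    using assms(3,4) x(3) unfolding represents_def by metis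
  from deficiency_vector_lincomb_eqD[OF F imaginary_unit_notin_Nats(2) this x(2)]
  show "M x = N x" by (simp add: x)
qed

lemma deficiency_isometry_hinner:
  assumes U: "U \<in> deficiency_isometries F" and f: "f \<in> hardy2" "g \<in> hardy2"
  shows "hinner (U f) (U g) = hinner (orth_proj (deficiency_plus F) f) g"
proof -
  have b: "bounded_op U" and "adj_op hardy2 U (U f) = orth_proj (deficiency_plus F) f"
    using U f unfolding deficiency_isometries_def by blast+
  then show ?thesis
    using hinner_adj_op_bounded[OF b bounded_op_hardy2[OF b f(1)] f(2)] by simp
qed

text \<open>As \<open>U\<^sup>* U\<close> is the projection \<open>P\<close>, the vector \<open>U g\<close> has norm \<open>0\<close> for every
  \<open>g\<close> with \<open>P g = 0\<close>; apply this to \<open>g = f - P f\<close>. Thus \<open>U\<close> is determined by its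
  values on the deficiency vectors.\<close>

lemma deficiency_isometry_eq_on_proj:
  assumes U: "U \<in> deficiency_isometries F" and f: "f \<in> hardy2"
  shows "U f = U (orth_proj (deficiency_plus F) f)"
proof -
  let ?S = "fs.span (deficiency_vector \<i> ` F)"
  have S: "deficiency_plus F = ?S" by (rule deficiency_plus_eq[OF F])
  have b: "bounded_op U" using U unfolding deficiency_isometries_def by blast
  let ?p = "orth_proj ?S f"
  have fin: "finite (deficiency_vector \<i> ` F)" using F(1) by simp
  have p: "?p \<in> ?S" by (rule orth_proj_in_span[OF fin plus_subset_hardy2 f])
  then have pH: "?p \<in> hardy2" using span_subset_hardy2[OF plus_subset_hardy2] by blast
  have g: "f - ?p \<in> hardy2" by (rule hardy2_diff[OF f pH])
  have "orth_proj ?S (f - ?p) = 0"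
    using orth_proj_orthogonal[OF fin plus_subset_hardy2 f] g
    by (intro orth_proj_eqI span_subset_hardy2 plus_subset_hardy2) (auto intro: fs.span_zero)
  then have "hinner (U (f - ?p)) (U (f - ?p)) = 0"
    using deficiency_isometry_hinner[OF U g g] S by simp
  then have "U (f - ?p) = 0"
    by (rule hinner_self_eq_0[OF bounded_op_hardy2[OF b g]])
  moreover have "U f = U (f - ?p) + U ?p"
    using bounded_op_add[OF b g pH] by simp
  ultimately show ?thesis by (simp add: S)
qed

lemma represents_unique_isometry:
  assumes U: "U \<in> deficiency_isometries F" "represents F U M"
    and U': "U' \<in> deficiency_isometries F" "represents F U' M"
  shows "U = U'"
proof -
  have b: "bounded_op U" "bounded_op U'"
    using U U' unfolding deficiency_isometries_def by blast+
  have "U \<in> hardy2 \<rightarrow>\<^sub>E hardy2" "U' \<in> hardy2 \<rightarrow>\<^sub>E hardy2"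
    using b unfolding bounded_op_def by blast+
  then show ?thesis
  proof (rule PiE_ext)
    fix f assume f: "f \<in> hardy2"
    have fin: "finite (deficiency_vector \<i> ` F)" using F(1) by simp
    obtain c where c: "orth_proj (deficiency_plus F) f = (\<Sum>\<beta>\<in>F. cscale (c \<beta>) (deficiency_vector \<i> \<beta>))"
      using span_image_sum[OF F(1) orth_proj_in_span[OF fin plus_subset_hardy2 f]]
        deficiency_plus_eq[OF F] by auto
    have "U (deficiency_vector \<i> \<beta>) = U' (deficiency_vector \<i> \<beta>)" if "\<beta> \<in> F" for \<beta>
      using U(2) U'(2) that unfolding represents_def by metis
    then have "U (orth_proj (deficiency_plus F) f) = U' (orth_proj (deficiency_plus F) f)"
      unfolding c using b F(1) plus_hardy2 by (simp add: bounded_op_sum)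
    then show "U f = U' f"
      using deficiency_isometry_eq_on_proj[OF U(1) f] deficiency_isometry_eq_on_proj[OF U'(1) f]
      by simp
  qed
qed

text \<open>On the initial space \<open>U\<^sup>* U\<close> is the identity, so \<open>U\<close> preserves the Gram matrix of the
  deficiency vectors; written in terms of the representing matrix, this is the matrix equation.\<close>

lemma deficiency_isometry_represented:
  assumes U: "U \<in> deficiency_isometries F"
  shows "\<exists>M\<in>Z_isometric_matrices F. represents F U M"
proof -
  let ?v = "deficiency_vector \<i>" and ?w = "deficiency_vector (- \<i>)"
  have "\<exists>c. U (?v \<beta>) = (\<Sum>\<alpha>\<in>F. cscale (c \<alpha>) (?w \<alpha>))" if "\<beta> \<in> F" for \<beta>
  proof -
    have "?v \<beta> \<in> deficiency_plus F"
      using that by (auto simp: deficiency_plus_eq[OF F] intro: fs.span_base)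
    then have "U (?v \<beta>) \<in> deficiency_minus F"
      using U unfolding deficiency_isometries_def by blast
    then show ?thesis
      using span_image_sum[OF F(1)] deficiency_minus_eq[OF F] by auto
  qed
  then obtain c where c: "\<And>\<beta>. \<beta> \<in> F \<Longrightarrow> U (?v \<beta>) = (\<Sum>\<alpha>\<in>F. cscale (c \<beta> \<alpha>) (?w \<alpha>))"
    by metis
  define M where "M = (\<lambda>(\<alpha>, \<beta>)\<in>F \<times> F. c \<beta> \<alpha>)"
  have rep: "represents F U M"
    unfolding represents_def by (auto simp: c M_def intro!: sum.cong)
  have "(\<Sum>\<gamma>\<in>F. \<Sum>\<xi>\<in>F. cnj (M (\<gamma>, \<alpha>)) * Z (angle \<gamma> - angle \<xi>) * M (\<xi>, \<beta>))
          = Z (angle \<alpha> - angle \<beta>)" if ab: "\<alpha> \<in> F" "\<beta> \<in> F" for \<alpha> \<beta>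
  proof -
    have "?v \<alpha> \<in> fs.span (?v ` F)" using ab by (auto intro: fs.span_base)
    then have "orth_proj (deficiency_plus F) (?v \<alpha>) = ?v \<alpha>"
      using orth_proj_id[OF plus_subset_hardy2] by (simp add: deficiency_plus_eq[OF F])
    then have "hinner (U (?v \<alpha>)) (U (?v \<beta>)) = hinner (?v \<alpha>) (?v \<beta>)"
      using deficiency_isometry_hinner[OF U, of "?v \<alpha>" "?v \<beta>"] ab plus_hardy2 by simp
    also have "\<dots> = Z (angle \<alpha> - angle \<beta>)"
      using ab by (simp add: hinner_deficiency_vector norm_F)
    finally show ?thesis
      using rep ab hinner_matrix_image[OF ab, of M] unfolding represents_def by simp
  qed
  then have "M \<in> Z_isometric_matrices F"
    unfolding Z_isometric_matrices_def M_def by auto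
  then show ?thesis using rep by blast
qed

text \<open>The matrix defines a linear map \<open>J\<close> between the spans of the two deficiency bases. The
  matrix equation says that \<open>J\<close> preserves inner products of basis vectors, so \<open>J\<close> is
  isometric, hence injective, hence onto. With \<open>P\<close>, \<open>Q\<close> the projections onto the two spans,
  \<open>U = J \<circ> P\<close> has the adjoint \<open>J\<inverse> \<circ> Q\<close>, from which both projection identities follow.\<close>

lemma matrix_represents_isometry:
  assumes M: "M \<in> Z_isometric_matrices F"
  shows "\<exists>U\<in>deficiency_isometries F. represents F U M"
proof -
  let ?v = "deficiency_vector \<i>" and ?w = "deficiency_vector (- \<i>)"
  let ?V = "fs.span (?v ` F)" and ?W = "fs.span (?w ` F)"
  note VH = plus_subset_hardy2 and WH = minus_subset_hardy2
  note iN = imaginary_unit_notin_Nats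
  have fin: "finite (?v ` F)" "finite (?w ` F)" using F(1) by auto
  have injv: "inj_on ?v F" by (rule inj_on_deficiency_vector[OF F(2) iN(1)])
  have injw: "inj_on ?w F" by (rule inj_on_deficiency_vector[OF F(2) iN(2)])
  define T where "T \<beta> = (\<Sum>\<alpha>\<in>F. cscale (M (\<alpha>, \<beta>)) (?w \<alpha>))" for \<beta>
  \<comment> \<open>\<open>J\<close> is linear on all functions, but the isometry property is claimed on \<open>?V\<close> alone\<close>
  obtain J where J: "Vector_Spaces.linear cscale cscale J"
    and Jx: "\<forall>x\<in>?v ` F. J x = T (the_inv_into F ?v x)"
    using fs_pair.linear_independent_extend[OF independent_deficiency_vectors[OF F iN(1)],
        of "\<lambda>x. T (the_inv_into F ?v x)"] by blast
  interpret J: Vector_Spaces.linear cscale cscale J by (rule J)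
  have Jv: "J (?v \<beta>) = T \<beta>" if "\<beta> \<in> F" for \<beta>
    using Jx that the_inv_into_f_f[OF injv that] by simp
  have TW: "T \<beta> \<in> ?W" for \<beta>
    unfolding T_def by (rule sum_in_span_image)
  have TH: "T \<beta> \<in> hardy2" for \<beta>
    using TW span_subset_hardy2[OF WH] by blast
  have gram: "hinner (T \<alpha>) (T \<beta>) = hinner (?v \<alpha>) (?v \<beta>)" if "\<alpha> \<in> F" "\<beta> \<in> F" for \<alpha> \<beta>
    using M that unfolding T_def Z_isometric_matrices_def
    by (simp add: hinner_matrix_image hinner_deficiency_vector norm_F)
  have iso: "hinner (J x) (J y) = hinner x y" if xy: "x \<in> ?V" "y \<in> ?V" for x y
  proof -
    obtain a b where ab: "x = (\<Sum>i\<in>F. cscale (a i) (?v i))" "y = (\<Sum>i\<in>F. cscale (b i) (?v i))"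
      using span_image_sum[OF F(1)] xy by metis
    have "J x = (\<Sum>i\<in>F. cscale (a i) (T i))" "J y = (\<Sum>i\<in>F. cscale (b i) (T i))"
      using Jv by (simp_all add: ab J.sum J.scale)
    then show ?thesis
      using gram by (simp add: ab hinner_lincomb TH plus_hardy2)
  qed
  have VH': "x \<in> hardy2" if "x \<in> ?V" for x using that span_subset_hardy2[OF VH] by blast
  have WH': "x \<in> hardy2" if "x \<in> ?W" for x using that span_subset_hardy2[OF WH] by blast
  have inj: "inj_on J ?V"
  proof (rule inj_onI)
    fix x y assume xy: "x \<in> ?V" "y \<in> ?V" "J x = J y"
    then have d: "x - y \<in> ?V" by (auto intro: fs.span_diff)
    have "J (x - y) = 0" using xy by (simp add: J.diff)
    then have "hinner (x - y) (x - y) = 0" using iso[OF d d] by simp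
    then show "x = y" using hinner_self_eq_0[OF VH'[OF d]] by simp
  qed
  have onto: "J ` ?V = ?W"
  proof (rule linear_image_span_onto[OF J inj independent_deficiency_vectors[OF F iN(1)] fin])
    show "card (?w ` F) \<le> card (?v ` F)"
      by (simp add: card_image injv injw)
    show "J ` ?v ` F \<subseteq> ?W" using Jv TW by auto
  qed
  let ?P = "orth_proj ?V" and ?Q = "orth_proj ?W"
  have P: "?P f \<in> ?V" if "f \<in> hardy2" for f by (rule orth_proj_in_span[OF fin(1) VH that])
  have Q: "?Q f \<in> ?W" if "f \<in> hardy2" for f by (rule orth_proj_in_span[OF fin(2) WH that])
  have JW: "J x \<in> ?W" if "x \<in> ?V" for x using onto that by blast
  define U where "U = (\<lambda>f\<in>hardy2. J (?P f))"
  have U: "U f = J (?P f)" if "f \<in> hardy2" for f using that by (simp add: U_def)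
  have UW: "U f \<in> ?W" if "f \<in> hardy2" for f using that by (simp add: U JW P)
  have UH: "U f \<in> hardy2" if "f \<in> hardy2" for f by (rule WH'[OF UW[OF that]])
  have U_V: "U x = J x" if "x \<in> ?V" for x
    using that by (simp add: U VH' orth_proj_id[OF VH])
  have bounded: "bounded_op U"
    unfolding bounded_op_def
  proof (intro conjI ballI allI)
    show "U \<in> hardy2 \<rightarrow>\<^sub>E hardy2"
      using UH unfolding U_def by (intro restrict_PiE_iff[THEN iffD2]) auto
    have "U (f + g) = U f + U g" if "f \<in> hardy2" "g \<in> hardy2" for f g
      using that by (simp add: U hardy2_add orth_proj_add[OF fin(1) VH] J.add)
    then show "U (\<lambda>z. f z + g z) = (\<lambda>z. U f z + U g z)" if "f \<in> hardy2" "g \<in> hardy2" for f g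
      using that by (simp add: plus_fun_def)
    have "U (cscale c f) = cscale c (U f)" if "f \<in> hardy2" for c f
      using that by (simp add: U hardy2_scale orth_proj_scale[OF fin(1) VH] J.scale)
    then show "U (\<lambda>z. c * f z) = (\<lambda>z. c * U f z)" if "f \<in> hardy2" for c f
      using that by (simp add: cscale_def)
    have "hnorm (U f) \<le> hnorm f" if f: "f \<in> hardy2" for f
    proof -
      have "complex_of_real ((hnorm (U f))\<^sup>2) = of_real ((hnorm (?P f))\<^sup>2)"
        using iso[OF P[OF f] P[OF f]] hinner_self[OF UH[OF f]] hinner_self[OF VH'[OF P[OF f]]]
        by (simp add: U[OF f])
      then have "(hnorm (U f))\<^sup>2 = (hnorm (?P f))\<^sup>2"
        by (simp only: of_real_eq_iff)
      then have "hnorm (U f) = hnorm (?P f)"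
        using hnorm_nonneg[OF UH[OF f]] hnorm_nonneg[OF VH'[OF P[OF f]]]
        by (simp add: power2_eq_iff_nonneg)
      then show ?thesis using hnorm_orth_proj_le[OF fin(1) VH f] by simp
    qed
    then show "\<exists>C. \<forall>f\<in>hardy2. hnorm (U f) \<le> C * hnorm f"
      by (intro exI[of _ 1]) simp
  qed
  have adj: "adj_op hardy2 U f = x" if f: "f \<in> hardy2" and x: "x \<in> ?V" "J x = ?Q f" for f x
  proof (rule adj_op_eqI[OF VH'[OF x(1)] _ subset_refl hardy2_dense])
    fix h assume h: "h \<in> hardy2"
    have "hinner f (U h) = hinner (?Q f) (U h)"
    proof -
      have "hinner (U h) f = hinner (U h) (?Q f)"
        by (rule hinner_orth_proj_right[OF fin(2) WH f UW[OF h], symmetric])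
      then show ?thesis
        using hinner_commute[OF UH[OF h]] f WH'[OF Q[OF f]] by metis
    qed
    also have "\<dots> = hinner (J x) (J (?P h))" by (simp add: x U h)
    also have "\<dots> = hinner x (?P h)" by (rule iso[OF x(1) P[OF h]])
    also have "\<dots> = hinner x h" by (rule hinner_orth_proj_right[OF fin(1) VH h x(1)])
    finally show "hinner f (U h) = hinner x h" .
  qed
  have "adj_op hardy2 U (U f) = ?P f" if f: "f \<in> hardy2" for f
    using orth_proj_id[OF WH UW[OF f]] by (intro adj UH P f) (simp add: U f)
  moreover have "U (adj_op hardy2 U f) = ?Q f" if f: "f \<in> hardy2" for f
  proof -
    obtain x where x: "x \<in> ?V" "J x = ?Q f" using Q[OF f] unfolding onto[symmetric] by (metis imageE)
    then show ?thesis by (simp add: adj[OF f x] U_V)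
  qed
  moreover have "U ` ?V \<subseteq> ?W" using UW VH' by blast
  ultimately have "U \<in> deficiency_isometries F"
    using bounded unfolding deficiency_isometries_def
    by (simp add: deficiency_plus_eq[OF F] deficiency_minus_eq[OF F])
  moreover have "represents F U M"
    unfolding represents_def using Jv by (auto simp: U_V fs.span_base T_def)
  ultimately show ?thesis by blast
qed

end

theorem corollary6p23:
  fixes F :: "complex set"
  assumes "finite F" and "F \<subseteq> sphere 0 1"
  shows "\<exists>\<Phi>. bij_betw \<Phi> (deficiency_isometries F) (Z_isometric_matrices F) \<and>
           (\<forall>U\<in>deficiency_isometries F. \<forall>\<beta>\<in>F.
              U (deficiency_vector \<i> \<beta>) =
                (\<lambda>z. \<Sum>\<alpha>\<in>F. \<Phi> U (\<alpha>, \<beta>) * deficiency_vector (- \<i>) \<alpha> z))"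
proof -
  obtain \<Phi> where \<Phi>: "\<And>U. U \<in> deficiency_isometries F \<Longrightarrow>
      \<Phi> U \<in> Z_isometric_matrices F \<and> represents F U (\<Phi> U)"
    using deficiency_isometry_represented[OF assms] by metis
  have "bij_betw \<Phi> (deficiency_isometries F) (Z_isometric_matrices F)"
  proof (rule bij_betw_imageI)
    show "inj_on \<Phi> (deficiency_isometries F)"
      using \<Phi> represents_unique_isometry[OF assms] by (intro inj_onI) metis
    show "\<Phi> ` deficiency_isometries F = Z_isometric_matrices F"
    proof (intro equalityI subsetI)
      fix M assume M: "M \<in> Z_isometric_matrices F"
      then obtain U where U: "U \<in> deficiency_isometries F" "represents F U M"
        using matrix_represents_isometry[OF assms] by blast
      have "\<Phi> U = M"
        using \<Phi>[OF U(1)] U(2) M unfolding Z_isometric_matrices_def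
        by (intro represents_unique_matrix[OF assms]) auto
      then show "M \<in> \<Phi> ` deficiency_isometries F" using U(1) by blast
    qed (use \<Phi> in auto)
  qed
  moreover have "U (deficiency_vector \<i> \<beta>) =
      (\<lambda>z. \<Sum>\<alpha>\<in>F. \<Phi> U (\<alpha>, \<beta>) * deficiency_vector (- \<i>) \<alpha> z)"
    if "U \<in> deficiency_isometries F" "\<beta> \<in> F" for U \<beta>
    using \<Phi>[OF that(1)] that(2) by (simp add: represents_def fun_eq_iff sum_fun_apply)
  ultimately show ?thesis by blast
qed

end
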